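(* For every $C_1,C_2>0$ there exists a constant $C>0$ (depending only on $C_1,C_2$) with the following property. Let $N\ge 1$ and let $M,r_1,\ldots,r_M$ be positive integers such that $M\ge 2$, $N=r_M+2(r_1+\cdots+r_{M-1})$, and $C_1 j\le r_j\le C_2 j$ for $1\le j\le M$. For $1\le j\le M-1$ let $h_j,H_j\in[0,1)$ be defined by \[ h_j=1-\frac{2}{N}\sum_{k=1}^{j-1}r_k-\frac{r_j}{N},\qquad H_j=h_j-\frac{r_j}{N}, \] and for $2\le j\le M$ write $r_j=6s_j+\mathrm{rem}_j$ with $s_j\ge 0$ an integer and $\mathrm{rem}_j\in\{0,\ldots,5\}$. Let $\rho(x)=\sqrt{(1-x)/(1+x)}$. Consider the degree $N$ polynomial $P_N(z)=P_N^{(1)}(z)P_N^{(2)}(z)P_N^{(3)}(z)P_N^{(4)}(z)$, where \[ P_N^{(1)}(z)=(z^{4s_M+\mathrm{rem}_M}-1)\left(z^{r_1}-\rho(h_1)^{r_1}\right)\left(z^{r_1}-1/\rho(h_1)^{r_1}\right), \] \[ P_N^{(2)}(z)=\left(z^{s_2}-\rho(H_1)^{s_2}\right)\left(z^{s_2}-1/\rho(H_1)^{s_2}\right), \] \[ P_N^{(3)}(z)=\prod_{j=2}^{M-1}\left(z^{4s_j+\mathrm{rem}_j}-\rho(h_j)^{4s_j+\mathrm{rem}_j}\right)\left(z^{4s_j+\mathrm{rem}_j}-1/\rho(h_j)^{4s_j+\mathrm{rem}_j}\right), \] \[ P_N^{(4)}(z)=\prod_{j=2}^{M-1}\left(z^{s_j+s_{j+1}}-\rho(H_j)^{s_j+s_{j+1}}\right)\left(z^{s_j+s_{j+1}}-1/\rho(H_j)^{s_j+s_{j+1}}\right),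 \] where, if $s_2=0$ or if $s_j+s_{j+1}=0$, the corresponding term is removed from the product. Then \[ \mu_{\rm norm}(P_N)\le C\sqrt{N}. \]
   Context: For a complex univariate polynomial $P(z)=\sum_{i=0}^N a_i z^i$ of degree $N$, the Weyl norm is $\|P\|=\left(\sum_{i=0}^N\binom{N}{i}^{-1}|a_i|^2\right)^{1/2}$. The normalized condition number of $P$ at a zero $z\in\mathbb{C}$ is \[ \mu_{\rm norm}(P,z)=N^{1/2}\,\frac{\|P\|\,(1+|z|^2)^{N/2-1}}{|P'(z)|}, \] with $\mu_{\rm norm}(P,z)=\infty$ if $P'(z)=0$ (i.e. $z$ is a multiple zero), and the normalized condition number of $P$ is $\mu_{\rm norm}(P)=\max_{z\in\mathbb{C}:P(z)=0}\mu_{\rm norm}(P,z)$. *)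

theory Defs
  imports
    "HOL-Analysis.Analysis"
    "HOL-Computational_Algebra.Computational_Algebra"
begin

definition weyl_norm :: "complex poly \<Rightarrow> real" where
  "weyl_norm p = sqrt (\<Sum>i\<le>degree p. inverse (real (degree p choose i)) * (cmod (coeff p i))\<^sup>2)"

(* The exponent N/2 - 1 is negative for N = 1, hence the real power. *)
definition mu_norm_at :: "complex poly \<Rightarrow> complex \<Rightarrow> ereal" where
  "mu_norm_at p z =
     (if poly (pderiv p) z = 0 then \<infinity>
      else ereal (sqrt (real (degree p)) *
             (weyl_norm p * (1 + (cmod z)\<^sup>2) powr (real (degree p) / 2 - 1)
                / cmod (poly (pderiv p) z))))"

(* Meaningful for nonconstant p, whose set of zeros is finite and nonempty. *)
definition mu_norm :: "complex poly \<Rightarrow> ereal" where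
  "mu_norm p = Max (mu_norm_at p ` {z. poly p z = 0})"

definition rho :: "real \<Rightarrow> real" where
  "rho x = sqrt ((1 - x) / (1 + x))"

definition h_mid :: "nat \<Rightarrow> (nat \<Rightarrow> nat) \<Rightarrow> nat \<Rightarrow> real" where
  "h_mid N r j = 1 - 2 / real N * (\<Sum>k=1..j-1. real (r k)) - real (r j) / real N"

definition h_low :: "nat \<Rightarrow> (nat \<Rightarrow> nat) \<Rightarrow> nat \<Rightarrow> real" where
  "h_low N r j = h_mid N r j - real (r j) / real N"

definition s_of :: "(nat \<Rightarrow> nat) \<Rightarrow> nat \<Rightarrow> nat" where
  "s_of r j = r j div 6"

definition rem_of :: "(nat \<Rightarrow> nat) \<Rightarrow> nat \<Rightarrow> nat" where
  "rem_of r j = r j mod 6"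

(* (z^m - c^m) (z^m - 1/c^m) *)
definition pair_factor :: "nat \<Rightarrow> real \<Rightarrow> complex poly" where
  "pair_factor m c =
     (monom 1 m - [:complex_of_real (c ^ m):]) * (monom 1 m - [:complex_of_real (1 / c ^ m):])"

definition P1 :: "nat \<Rightarrow> nat \<Rightarrow> (nat \<Rightarrow> nat) \<Rightarrow> complex poly" where
  "P1 N M r = (monom 1 (4 * s_of r M + rem_of r M) - 1) * pair_factor (r 1) (rho (h_mid N r 1))"

definition P2 :: "nat \<Rightarrow> (nat \<Rightarrow> nat) \<Rightarrow> complex poly" where
  "P2 N r = (if s_of r 2 = 0 then 1 else pair_factor (s_of r 2) (rho (h_low N r 1)))"

definition P3 :: "nat \<Rightarrow> nat \<Rightarrow> (nat \<Rightarrow> nat) \<Rightarrow> complex poly" where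
  "P3 N M r = (\<Prod>j=2..M-1. pair_factor (4 * s_of r j + rem_of r j) (rho (h_mid N r j)))"

definition P4 :: "nat \<Rightarrow> nat \<Rightarrow> (nat \<Rightarrow> nat) \<Rightarrow> complex poly" where
  "P4 N M r = (\<Prod>j=2..M-1. if s_of r j + s_of r (j + 1) = 0 then 1
                 else pair_factor (s_of r j + s_of r (j + 1)) (rho (h_low N r j)))"

definition P_N :: "nat \<Rightarrow> nat \<Rightarrow> (nat \<Rightarrow> nat) \<Rightarrow> complex poly" where
  "P_N N M r = P1 N M r * P2 N r * P3 N M r * P4 N M r"

lemma h_low_bounds:
  assumes "N = r M + 2 * (\<Sum>j=1..M-1. r j)" "\<forall>j\<in>{1..M}. 0 < r j" "j \<in> {1..M-1}"
  shows "0 \<le> h_low N r j" "h_low N r j < h_mid N r j" "h_mid N r j < 1"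
proof -
  have M: "2 \<le> M" using assms(3) by auto
  have rj: "0 < r j" using assms by auto
  have "(\<Sum>k=1..j. r k) \<le> (\<Sum>k=1..M-1. r k)" using assms(3) by (intro sum_mono2) auto
  moreover have "(\<Sum>k=1..j. r k) = (\<Sum>k=1..j-1. r k) + r j"
    using assms(3) by (cases j) auto
  ultimately have le: "2 * ((\<Sum>k=1..j-1. r k) + r j) \<le> N" using assms(1) by simp
  have "r j \<le> 2 * (a + r j)" for a :: nat by simp
  from le_trans[OF this le] have N: "0 < N" using rj by (rule less_le_trans[rotated])
  have le': "2 * ((\<Sum>k=1..j-1. real (r k)) + real (r j)) \<le> real N"
    using of_nat_mono[OF le, where 'a = real]
    unfolding of_nat_mult of_nat_add of_nat_sum of_nat_numeral .
  have "h_low N r j = 1 - 2 * ((\<Sum>k=1..j-1. real (r k)) + real (r j)) / real N"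
    unfolding h_low_def h_mid_def using N by (simp add: field_simps)
  moreover have "2 * ((\<Sum>k=1..j-1. real (r k)) + real (r j)) / real N \<le> 1" using le' N by simp
  ultimately show "0 \<le> h_low N r j" by linarith
  show "h_low N r j < h_mid N r j" unfolding h_low_def using rj N by simp
  have "0 \<le> 2 / real N * (\<Sum>k=1..j-1. real (r k))" by (simp add: sum_nonneg)
  moreover have "0 < real (r j) / real N" using rj N by simp
  ultimately show "h_mid N r j < 1" unfolding h_mid_def by linarith
qed

lemma degree_monom_minus_const:
  "0 < m \<Longrightarrow> degree (monom (1::complex) m - [:c:]) = m"
  by (rule antisym[OF degree_le le_degree]) (auto simp: coeff_pCons split: nat.splits)

lemma pair_factor_degree:
  assumes "0 < m"
  shows "degree (pair_factor m c) = 2 * m" "pair_factor m c \<noteq> 0"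
proof -
  have nz: "monom (1::complex) m - [:c:] \<noteq> 0" for c
    using degree_monom_minus_const[OF assms, of c] assms by (metis degree_0 less_irrefl)
  show "degree (pair_factor m c) = 2 * m" "pair_factor m c \<noteq> 0"
    unfolding pair_factor_def
    using nz degree_monom_minus_const[OF assms] by (simp_all add: degree_mult_eq del: of_real_power)
qed

lemma degree_P_N:
  assumes "M \<ge> 2" "N = r M + 2 * (\<Sum>j=1..M-1. r j)" "\<forall>j\<in>{1..M}. 0 < r j"
  shows "degree (P_N N M r) = N"
proof -
  define t where "t j = 4 * s_of r j + rem_of r j" for j
  have rs: "r j = t j + 2 * s_of r j" for j
    unfolding t_def s_of_def rem_of_def by presburger
  have t: "0 < t j" if "j \<in> {1..M}" for j
  proof -
    have "0 < r j" using assms(3) that by blast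
    then show ?thesis using rs[of j] by (auto simp: t_def)
  qed
  define F2 where "F2 j = (if s_of r j + s_of r (j + 1) = 0 then 1
                 else pair_factor (s_of r j + s_of r (j + 1)) (rho (h_low N r j)))" for j
  have F2: "F2 j \<noteq> 0" "degree (F2 j) = 2 * (s_of r j + s_of r (j + 1))" for j
    unfolding F2_def using pair_factor_degree[of "s_of r j + s_of r (j + 1)"] by auto
  have d1: "degree (monom (1::complex) (t M) - 1) = t M"
    using degree_monom_minus_const[of "t M" 1] t[of M] assms(1) by (simp add: one_pCons)
  have n1: "monom (1::complex) (t M) - 1 \<noteq> 0"
    using d1 t[of M] assms(1) by (metis atLeastAtMost_iff degree_0 le_refl less_irrefl one_le_numeral order_trans)
  have 1: "degree (P1 N M r) = t M + 2 * r 1" "P1 N M r \<noteq> 0"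
    using d1 n1 pair_factor_degree[of "r 1"] assms unfolding P1_def t_def[symmetric]
    by (simp_all add: degree_mult_eq)
  have 2: "degree (P2 N r) = 2 * s_of r 2" "P2 N r \<noteq> 0"
    unfolding P2_def using pair_factor_degree[of "s_of r 2"] by auto
  have F3: "degree (pair_factor (t j) c) = 2 * t j" "pair_factor (t j) c \<noteq> 0"
    if "j \<in> {2..M-1}" for j c
    using pair_factor_degree[of "t j" c] t[of j] that by fastforce+
  have 3: "degree (P3 N M r) = (\<Sum>j=2..M-1. 2 * t j)" "P3 N M r \<noteq> 0"
  proof -
    have "degree (P3 N M r) = (\<Sum>j=2..M-1. degree (pair_factor (t j) (rho (h_mid N r j))))"
      unfolding P3_def t_def[symmetric] by (rule degree_prod_sum_eq) (use F3 in blast)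
    also have "\<dots> = (\<Sum>j=2..M-1. 2 * t j)" by (rule sum.cong) (use F3 in auto)
    finally show "degree (P3 N M r) = (\<Sum>j=2..M-1. 2 * t j)" .
    show "P3 N M r \<noteq> 0"
      unfolding P3_def t_def[symmetric] prod_zero_iff[OF finite_atLeastAtMost] using F3 by blast
  qed
  have 4: "degree (P4 N M r) = (\<Sum>j=2..M-1. 2 * (s_of r j + s_of r (j + 1)))" "P4 N M r \<noteq> 0"
    unfolding P4_def F2_def[symmetric]
    using F2 by (auto simp: degree_prod_sum_eq)
  have deg: "degree (P_N N M r) = t M + 2 * r 1 + 2 * s_of r 2 + (\<Sum>j=2..M-1. 2 * t j)
      + (\<Sum>j=2..M-1. 2 * (s_of r j + s_of r (j + 1)))"
    unfolding P_N_def using 1 2 3 4 by (simp add: degree_mult_eq)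
  obtain m where m: "M = m + 2" using assms(1) by (metis le_add_diff_inverse2)
  have "2 * s_of r 2 + (\<Sum>j=2..n+1. 2 * t j) + (\<Sum>j=2..n+1. 2 * (s_of r j + s_of r (j + 1)))
      = (\<Sum>j=2..n+1. 2 * r j) + 2 * s_of r (n + 2)" for n
  proof (induction n)
    case (Suc n)
    have *: "{2..Suc n + 1} = insert (n + 2) {2..n+1}" by auto
    show ?case unfolding * using Suc rs[of "n + 2"] by simp
  qed (simp add: numeral_2_eq_2)
  from this[of m] have "degree (P_N N M r) = r M + 2 * r 1 + (\<Sum>j=2..M-1. 2 * r j)"
    using deg rs[of M] unfolding m by simp
  moreover have "{1..M-1} = insert 1 {2..M-1}" using assms(1) by auto
  ultimately show ?thesis using assms(2) by (simp add: sum_distrib_left)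
qed

end

theory Submission
  imports Defs
begin

text \<open>
  Measure the height \<open>h\<close> of the stereographic image of \<open>z\<close> by \<open>y = N (1 - h) / 2\<close>, the number
  of points that a uniform distribution of \<open>N\<close> points on the sphere has above that height;
  then \<open>\<bar>z\<bar>\<^sup>2 = y / (N - y)\<close>. Let \<open>R j = r 1 + \<dots> + r j\<close>. In this coordinate the zeros lie
  on circles at the band ends \<open>R j\<close> and at the band midpoints \<open>(R (j - 1) + R j) / 2\<close>, on the
  mirror images \<open>N - y\<close> of these circles, and on the equator \<open>N / 2\<close>. Each band carries \<open>r j\<close>
  zeros, split between its two ends and its midpoint as 1 : 4 : 1 up to the remainder
  modulo 6: these are the weights of Simpson's rule. Only the first band, next to the pole,
  keeps all its zeros at its midpoint.

  The claim follows from two estimates with constants that depend on \<open>C1\<close> and \<open>C2\<close> only. The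
  quotient \<open>\<bar>P z\<bar> / (1 + \<bar>z\<bar>\<^sup>2) powr (N / 2)\<close> is bounded on the plane (\<open>P_sup_bound\<close>,
  \<open>P_sq_bound\<close>), and at each zero \<open>\<bar>P' z\<bar>\<close> is at least a constant times
  \<open>sqrt N * (1 + \<bar>z\<bar>\<^sup>2) powr (N / 2 - 1)\<close> (\<open>P_deriv_bound\<close>). The squared Weyl norm is at most
  \<open>N + 1\<close> times the square of the first bound (\<open>weyl_norm_le_sup\<close>), and dividing by the second
  bound leaves a constant times \<open>sqrt N\<close>. Since \<open>z ^ N * P (1 / z) = - P z\<close>, only
  \<open>\<bar>z\<bar> \<le> 1\<close> has to be examined.

  Both estimates come from writing \<open>\<bar>z ^ m - a ^ m\<bar>\<close> as \<open>max \<bar>z\<bar> a ^ m\<close> times a number between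
  \<open>1 - q ^ m\<close> and \<open>1 + q ^ m\<close>, where \<open>q\<close> is the smaller of \<open>\<bar>z\<bar> / a\<close> and \<open>a / \<bar>z\<bar>\<close>.

  The product of the maxima depends on \<open>\<bar>z\<bar>\<close> only. Its logarithm minus
  \<open>N / 2 * ln (1 + \<bar>z\<bar>\<^sup>2)\<close> would vanish for the uniform distribution; for the actual
  circles it changes over the band \<open>j\<close> by a Simpson error of order \<open>1 / j\<^sup>2\<close>
  (\<open>simpson_log\<close>, \<open>potential_band\<close>), so it stays bounded however many bands there are
  (\<open>radial_potential_bounded\<close>).

  For the correction factors, \<open>r j\<close> comparable to \<open>j\<close> means that circles number \<open>k\<close> and \<open>k + 1\<close>
  have radii whose ratio is at most \<open>1 - c / k\<close>, while each carries about \<open>k\<close> zeros. Hence \<open>q ^ m\<close> decays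
  geometrically in the number of circles between \<open>z\<close> and the circle considered, and the sum
  of all \<open>q ^ m\<close> is bounded (\<open>influence_sum\<close>). At a zero the other circles have
  \<open>q ^ m \<le> \<theta> < 1\<close> (\<open>influence_at_node\<close>), which keeps the product of the \<open>1 - q ^ m\<close> away
  from 0; the circle through the zero contributes \<open>m / a\<close>, and that is of order \<open>sqrt N\<close>
  (\<open>mult_over_rad_ge\<close>).
\<close>

section \<open>The Weyl norm and the supremum norm\<close>

text \<open>
  Characters of the cyclic group of order \<open>n\<close> are orthogonal: for \<open>i \<noteq> j\<close> the sum is geometric,
  with a ratio that is a nontrivial root of unity.
\<close>

lemma roots_of_unity_orthogonal:
  fixes n :: nat
  assumes "i < n" "j < n"
  defines "w \<equiv> \<lambda>k. cis (2 * pi * real k / real n)"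
  shows "(\<Sum>k<n. w k ^ i * cnj (w k) ^ j) = (if i = j then of_nat n else 0)"
proof -
  have n: "n > 0" using assms(1) by simp
  define v where "v = cis (2 * pi * (real i - real j) / real n)"
  have wk: "w k ^ i * cnj (w k) ^ j = v ^ k" for k
  proof -
    have "w k ^ i * cnj (w k) ^ j
        = cis (real i * (2 * pi * real k / real n) + real j * - (2 * pi * real k / real n))"
      unfolding w_def cis_cnj Complex.DeMoivre cis_mult ..
    also have "real i * (2 * pi * real k / real n) + real j * - (2 * pi * real k / real n)
        = real k * (2 * pi * (real i - real j) / real n)"
      using n by (simp add: field_simps)
    finally show ?thesis unfolding v_def Complex.DeMoivre .
  qed
  show ?thesis
  proof (cases "i = j")
    case True
    then show ?thesis unfolding wk by (simp add: v_def)
  next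
    case False
    have "v \<noteq> 1"
    proof
      assume "v = 1"
      then obtain q :: int where "2 * pi * (real i - real j) / real n = of_int (2 * q) * pi"
        unfolding v_def cis_conv_exp exp_eq_1 by auto
      then have "pi * (2 * (real i - real j)) = pi * (2 * (of_int q * real n))"
        using n by (simp add: field_simps)
      then have "real_of_int (int i - int j) = real_of_int (q * int n)"
        unfolding mult_cancel_left by simp
      then have eq: "int i - int j = q * int n" by (simp only: of_int_eq_iff)
      have "\<bar>int i - int j\<bar> < int n" using assms by linarith
      then have "\<bar>q\<bar> * int n < 1 * int n" using eq by (simp add: abs_mult)
      then have "\<bar>q\<bar> < 1" using n mult_less_cancel_right_pos[of "int n"] by simp
      with eq False show False by simp
    qed
    have "v ^ n = 1"
    proof -
      have "v ^ n = cis (2 * pi * of_int (int i - int j))"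
      proof -
        have "real n * (2 * pi * (real i - real j) / real n) = 2 * pi * of_int (int i - int j)"
          using n by simp
        then show ?thesis unfolding v_def Complex.DeMoivre by (rule arg_cong)
      qed
      also have "\<dots> = 1" by (rule cis_multiple_2pi) simp
      finally show ?thesis .
    qed
    then have "(\<Sum>k<n. v ^ k) = 0" using \<open>v \<noteq> 1\<close> by (simp add: geometric_sum)
    then show ?thesis unfolding wk using False by simp
  qed
qed

text \<open>
  Averaging over more than \<open>degree p\<close> equally spaced points replaces the integral over a circle.
\<close>

lemma parseval_poly:
  fixes p :: "complex poly" and x :: real and n :: nat
  assumes "degree p < n"
  shows "(\<Sum>k<n. (cmod (poly p (of_real x * cis (2 * pi * real k / real n))))\<^sup>2)
       = real n * (\<Sum>i\<le>degree p. (cmod (coeff p i))\<^sup>2 * x ^ (2 * i))"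
proof -
  define w where "w = (\<lambda>k. cis (2 * pi * real k / real n))"
  let ?d = "degree p"
  let ?a = "\<lambda>i. coeff p i * of_real x ^ i"
  have "complex_of_real (\<Sum>k<n. (cmod (poly p (of_real x * w k)))\<^sup>2)
      = (\<Sum>k<n. \<Sum>i\<le>?d. \<Sum>j\<le>?d. (?a i * w k ^ i) * cnj (?a j * w k ^ j))"
    unfolding of_real_sum complex_norm_square poly_altdef cnj_sum sum_product
    by (simp add: power_mult_distrib mult_ac)
  also have "\<dots> = (\<Sum>i\<le>?d. \<Sum>k<n. \<Sum>j\<le>?d. (?a i * w k ^ i) * cnj (?a j * w k ^ j))"
    by (rule sum.swap)
  also have "\<dots> = (\<Sum>i\<le>?d. \<Sum>j\<le>?d. \<Sum>k<n. (?a i * w k ^ i) * cnj (?a j * w k ^ j))"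
    by (intro sum.cong refl sum.swap)
  also have "\<dots> = (\<Sum>i\<le>?d. \<Sum>j\<le>?d. ?a i * cnj (?a j) * (\<Sum>k<n. w k ^ i * cnj (w k) ^ j))"
    by (simp add: sum_distrib_left mult_ac)
  also have "\<dots> = (\<Sum>i\<le>?d. \<Sum>j\<le>?d. if i = j then of_nat n * (?a i * cnj (?a i)) else 0)"
    using assms unfolding w_def
    by (intro sum.cong refl) (subst roots_of_unity_orthogonal, auto)
  also have "\<dots> = complex_of_real (real n * (\<Sum>i\<le>?d. (cmod (coeff p i))\<^sup>2 * x ^ (2 * i)))"
    unfolding of_real_sum of_real_mult sum_distrib_left complex_norm_square
    by (simp add: power_mult power2_eq_square power_mult_distrib mult_ac)
  finally show ?thesis unfolding w_def of_real_eq_iff .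
qed

text \<open>
  The Beta integral explains the weights of the Weyl norm: the reciprocal binomial coefficients
  are, up to \<open>n + 1\<close>, the integrals of \<open>t ^ i * (1 - t) ^ (n - i)\<close>.
\<close>

lemma bernstein_integral:
  assumes "i \<le> n"
  shows "((\<lambda>t. t ^ i * (1 - t) ^ (n - i)) has_integral
           inverse (real (n choose i)) / real (n + 1)) {0..1}"
proof -
  have "((\<lambda>t. t powr (real i + 1 - 1) * (1 - t) powr (real (n - i) + 1 - 1)) has_integral
          Beta (real i + 1) (real (n - i) + 1)) {0..1}"
    by (rule has_integral_Beta_real) auto
  also have "Beta (real i + 1) (real (n - i) + 1) = fact i * fact (n - i) / fact (n + 1)"
  proof -
    have "real i + 1 + (real (n - i) + 1) = real (n + 1) + 1" using assms by simp
    then show ?thesis unfolding Beta_def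
      by (metis Gamma_fact add.commute)
  qed
  also have "\<dots> = inverse (real (n choose i)) / real (n + 1)"
    using assms by (simp add: binomial_fact)
  finally show ?thesis
  proof (rule has_integral_spike[rotated 2])
    show "negligible {0, 1::real}" by simp
  qed (auto simp: powr_realpow)
qed

text \<open>
  Parseval on the circle of squared radius \<open>t / (1 - t)\<close>, multiplied by \<open>(1 - t) ^ N\<close> and
  integrated over \<open>t\<close>, gives the Weyl norm: it is the root mean square of
  \<open>\<bar>p\<bar> / (1 + \<bar>z\<bar>\<^sup>2) powr (N / 2)\<close> over the sphere, times \<open>sqrt (N + 1)\<close>. Excluding \<open>z = 0\<close>
  from the hypothesis makes the lemma applicable to bounds that are transported by
  \<open>z \<mapsto> 1 / z\<close>.
\<close>

lemma weyl_norm_le_sup: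
  fixes p :: "complex poly" and S :: real
  assumes S: "\<And>z. z \<noteq> 0 \<Longrightarrow> (cmod (poly p z))\<^sup>2 \<le> S * (1 + (cmod z)\<^sup>2) ^ degree p"
  shows "weyl_norm p \<le> sqrt ((real (degree p) + 1) * S)"
proof -
  let ?N = "degree p"
  let ?f = "\<lambda>t. \<Sum>i\<le>?N. (cmod (coeff p i))\<^sup>2 * (t ^ i * (1 - t) ^ (?N - i))"
  have circle: "(\<Sum>i\<le>?N. (cmod (coeff p i))\<^sup>2 * u ^ i) \<le> S * (1 + u) ^ ?N" if "u > 0" for u :: real
  proof -
    let ?n = "Suc ?N"
    have "real ?n * (\<Sum>i\<le>?N. (cmod (coeff p i))\<^sup>2 * u ^ i)
        = (\<Sum>k<?n. (cmod (poly p (of_real (sqrt u) * cis (2 * pi * real k / real ?n))))\<^sup>2)"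
      using parseval_poly[of p ?n "sqrt u"] that by (simp add: power_mult)
    also have "\<dots> \<le> (\<Sum>k<?n. S * (1 + u) ^ ?N)"
    proof (rule sum_mono)
      fix k
      have "(cmod (of_real (sqrt u) * cis (2 * pi * real k / real ?n)))\<^sup>2 = u"
        using that by (simp add: norm_mult)
      moreover have "of_real (sqrt u) * cis (2 * pi * real k / real ?n) \<noteq> 0"
        using that by simp
      ultimately show "(cmod (poly p (of_real (sqrt u) * cis (2 * pi * real k / real ?n))))\<^sup>2
            \<le> S * (1 + u) ^ ?N"
        using S[of "of_real (sqrt u) * cis (2 * pi * real k / real ?n)"] by metis
    qed
    also have "\<dots> = real ?n * (S * (1 + u) ^ ?N)" by simp
    finally show ?thesis by (simp add: mult_le_cancel_left_pos)
  qed
  have le: "?f t \<le> S" if "t \<in> {0<..<1}" for t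
  proof -
    have t: "0 < t" "t < 1" using that by auto
    have "?f t = (1 - t) ^ ?N * (\<Sum>i\<le>?N. (cmod (coeff p i))\<^sup>2 * (t / (1 - t)) ^ i)"
      unfolding sum_distrib_left using t
      by (intro sum.cong refl) (simp add: power_divide power_diff field_simps)
    also have "\<dots> \<le> (1 - t) ^ ?N * (S * (1 + t / (1 - t)) ^ ?N)"
      using t by (intro mult_left_mono circle) auto
    also have "\<dots> = S * ((1 - t) * (1 + t / (1 - t))) ^ ?N"
      by (simp add: power_mult_distrib)
    also have "(1 - t) * (1 + t / (1 - t)) = 1" using t by (simp add: field_simps)
    finally show ?thesis by simp
  qed
  have 1: "?f t \<le> S" if "t \<in> {0..1}" for t
  proof -
    have cl: "closure {0<..<1::real} = {0..1}" by simp
    have "continuous_on (closure {0<..<1}) ?f" by (intro continuous_intros)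
    from continuous_le_on_closure[OF this, of t S] le that show ?thesis unfolding cl by blast
  qed
  have 2: "(?f has_integral (\<Sum>i\<le>?N. (cmod (coeff p i))\<^sup>2 *
      (inverse (real (?N choose i)) / real (?N + 1)))) {0..1}"
    by (intro has_integral_sum has_integral_mult_right bernstein_integral) auto
  have 3: "((\<lambda>t. S) has_integral S) {0..1::real}"
    using has_integral_const_real[of S 0 1] by simp
  have "(\<Sum>i\<le>?N. (cmod (coeff p i))\<^sup>2 * (inverse (real (?N choose i)) / real (?N + 1))) \<le> S"
    by (rule has_integral_le[OF 2 3 1])
  also have "(\<Sum>i\<le>?N. (cmod (coeff p i))\<^sup>2 * (inverse (real (?N choose i)) / real (?N + 1)))
      = (\<Sum>i\<le>?N. inverse (real (?N choose i)) * (cmod (coeff p i))\<^sup>2) / real (?N + 1)"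
    unfolding sum_divide_distrib by (intro sum.cong refl) simp
  finally have "(\<Sum>i\<le>?N. inverse (real (?N choose i)) * (cmod (coeff p i))\<^sup>2) / real (?N + 1) \<le> S" .
  then have "(\<Sum>i\<le>?N. inverse (real (?N choose i)) * (cmod (coeff p i))\<^sup>2) \<le> (real ?N + 1) * S"
    by (simp add: field_simps)
  then show ?thesis unfolding weyl_norm_def by (rule real_sqrt_le_mono)
qed

section \<open>Inversion in the unit circle\<close>

text \<open>
  Differentiate \<open>p w = - (w ^ n * p (1 / w))\<close> at a zero; the term in which \<open>w ^ n\<close> is
  differentiated vanishes there.
\<close>

lemma pderiv_reciprocal_zero:
  fixes p :: "complex poly"
  assumes refl: "reflect_poly p = - p" and z: "z \<noteq> 0" "poly p z = 0"
  shows "(cmod z)\<^sup>2 * cmod (poly (pderiv p) z) = cmod z ^ degree p * cmod (poly (pderiv p) (inverse z))"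
proof -
  let ?n = "degree p"
  have p: "poly p w = - (w ^ ?n * poly p (inverse w))" if "w \<noteq> 0" for w
    using poly_reflect_poly_nz[OF that, of p] unfolding refl poly_minus by (metis minus_minus)
  have p0: "poly p (inverse z) = 0" using p[OF z(1)] z by simp
  have "((\<lambda>w. - (w ^ ?n * poly p (inverse w))) has_field_derivative
      z ^ ?n * poly (pderiv p) (inverse z) * inverse (z\<^sup>2)) (at z)"
    using z p0 by (auto intro!: derivative_eq_intros poly_DERIV[THEN DERIV_chain2] simp: power2_eq_square)
  then have "(poly p has_field_derivative z ^ ?n * poly (pderiv p) (inverse z) * inverse (z\<^sup>2)) (at z)"
  proof (rule has_field_derivative_transform_within_open)
    show "open (- {0 :: complex})" by auto
    show "z \<in> - {0}" using z by simp
    show "- (w ^ ?n * poly p (inverse w)) = poly p w" if "w \<in> - {0}" for w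
      using p[of w] that by simp
  qed
  then have "poly (pderiv p) z = z ^ ?n * poly (pderiv p) (inverse z) * inverse (z\<^sup>2)"
    by (rule DERIV_unique[OF poly_DERIV])
  then have "cmod (poly (pderiv p) z) = cmod z ^ ?n * cmod (poly (pderiv p) (inverse z)) * inverse ((cmod z)\<^sup>2)"
    by (simp add: norm_mult norm_power norm_inverse)
  then show ?thesis using z by (simp add: field_simps)
qed

text \<open>
  The map \<open>z \<mapsto> 1 / z\<close> is a rotation of the Riemann sphere, under which the condition number is
  invariant, and the hypothesis says that this rotation preserves \<open>p\<close> up to sign.
\<close>

lemma mu_norm_at_reciprocal:
  fixes p :: "complex poly"
  assumes refl: "reflect_poly p = - p" and z: "z \<noteq> 0" "poly p z = 0"
  shows "mu_norm_at p (inverse z) = mu_norm_at p z"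
proof -
  let ?n = "degree p"
  let ?d = "cmod (poly (pderiv p) z)" and ?d' = "cmod (poly (pderiv p) (inverse z))"
  let ?w = "cmod z"
  have w: "0 < ?w" using z by simp
  have d: "?w\<^sup>2 * ?d = ?w ^ ?n * ?d'" by (rule pderiv_reciprocal_zero[OF refl z])
  have zero: "poly (pderiv p) (inverse z) = 0 \<longleftrightarrow> poly (pderiv p) z = 0" using d w by auto
  have "1 + (inverse ?w)\<^sup>2 = (1 + ?w\<^sup>2) / ?w\<^sup>2" using w by (simp add: field_simps)
  then have "(1 + (inverse ?w)\<^sup>2) powr (real ?n / 2 - 1)
      = (1 + ?w\<^sup>2) powr (real ?n / 2 - 1) / (?w\<^sup>2) powr (real ?n / 2 - 1)"
    by (simp add: powr_divide)
  also have "(?w\<^sup>2) powr (real ?n / 2 - 1) = ?w ^ ?n / ?w\<^sup>2"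
  proof -
    have "(?w\<^sup>2) powr (real ?n / 2 - 1) = (?w powr 2) powr (real ?n / 2 - 1)"
      using w by (simp only: powr_numeral)
    also have "\<dots> = ?w powr (2 * (real ?n / 2 - 1))" by (rule powr_powr)
    also have "\<dots> = ?w powr (real ?n - 2)" by (simp add: right_diff_distrib)
    also have "\<dots> = ?w ^ ?n / ?w\<^sup>2" using w by (simp add: powr_diff powr_realpow)
    finally show ?thesis .
  qed
  finally have e: "(1 + (inverse ?w)\<^sup>2) powr (real ?n / 2 - 1)
      = (1 + ?w\<^sup>2) powr (real ?n / 2 - 1) * (?w\<^sup>2 / ?w ^ ?n)" by simp
  have d': "?d' = ?d * (?w\<^sup>2 / ?w ^ ?n)" using d w by (simp add: field_simps)
  have c: "?w\<^sup>2 / ?w ^ ?n \<noteq> 0" using w by simp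
  show ?thesis unfolding mu_norm_at_def zero norm_inverse e d' using c by simp
qed

lemma reflect_poly_prod_fixed:
  fixes f :: "'a \<Rightarrow> complex poly"
  assumes "\<And>k. k \<in> A \<Longrightarrow> reflect_poly (f k) = f k"
  shows "reflect_poly (prod f A) = prod f A"
  using assms by (simp add: reflect_poly_prod)

lemma poly_pair_factor:
  "poly (pair_factor m c) z = (z ^ m - of_real (c ^ m)) * (z ^ m - of_real (1 / c ^ m))"
  by (simp add: pair_factor_def poly_monom)

lemma poly_eqI_nonzero:
  fixes p q :: "complex poly"
  assumes "\<And>z. z \<noteq> 0 \<Longrightarrow> poly p z = poly q z"
  shows "p = q"
proof -
  have "poly (monom 1 1 * p) z = poly (monom 1 1 * q) z" for z
    using assms[of z] by (cases "z = 0") (simp_all add: poly_monom)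
  then have "monom 1 1 * p = monom 1 1 * q" by (simp add: poly_eq_poly_eq_iff[symmetric] fun_eq_iff)
  then show ?thesis using mult_left_cancel[of "monom (1::complex) 1" p q] by simp
qed

lemma reflect_pair_factor:
  assumes "0 < m" "c \<noteq> 0"
  shows "reflect_poly (pair_factor m c) = pair_factor m c"
proof (rule poly_eqI_nonzero)
  fix z :: complex assume z: "z \<noteq> 0"
  have "poly (reflect_poly (pair_factor m c)) z = z ^ (2 * m) * poly (pair_factor m c) (inverse z)"
    using poly_reflect_poly_nz[OF z, of "pair_factor m c"] pair_factor_degree(1)[OF assms(1), of c] by simp
  also have "\<dots> = poly (pair_factor m c) z"
  proof -
    have "Z * Z * ((inverse Z - a) * (inverse Z - 1 / a)) = (Z - a) * (Z - 1 / a)"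
      if "Z \<noteq> 0" "a \<noteq> 0" for Z a :: complex
      using that by (simp add: field_simps)
    then show ?thesis
      using z assms unfolding poly_pair_factor by (simp add: mult_2 power_add power_inverse)
  qed
  finally show "poly (reflect_poly (pair_factor m c)) z = poly (pair_factor m c) z" .
qed

lemma reflect_unit_circle_factor:
  assumes "0 < m"
  shows "reflect_poly (monom 1 m - 1 :: complex poly) = - (monom 1 m - 1)"
proof (rule poly_eqI_nonzero)
  fix z :: complex assume z: "z \<noteq> 0"
  have "degree (monom 1 m - 1 :: complex poly) = m"
    using degree_monom_minus_const[OF assms, of 1] by (simp add: one_pCons)
  then show "poly (reflect_poly (monom 1 m - 1)) z = poly (- (monom 1 m - 1)) z"
    using poly_reflect_poly_nz[OF z, of "monom 1 m - 1"] z
    by (simp add: poly_monom power_inverse right_diff_distrib)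
qed

lemma norm_power_diff_bounds:
  fixes z :: complex
  assumes "0 < c"
  shows "max (cmod z) c ^ m * (1 - (min (cmod z) c / max (cmod z) c) ^ m) \<le> cmod (z ^ m - of_real (c ^ m))"
    and "cmod (z ^ m - of_real (c ^ m)) \<le> max (cmod z) c ^ m * (1 + (min (cmod z) c / max (cmod z) c) ^ m)"
proof -
  let ?w = "cmod z"
  have pos: "0 < max ?w c" using assms by simp
  then have e: "max ?w c ^ m * (min ?w c / max ?w c) ^ m = min ?w c ^ m"
    by (simp flip: power_mult_distrib)
  have n: "cmod (z ^ m) = ?w ^ m" "cmod (of_real (c ^ m)) = c ^ m"
    using assms by (simp_all add: norm_power)
  have "max ?w c ^ m - min ?w c ^ m \<le> cmod (z ^ m - of_real (c ^ m))"
    using norm_triangle_ineq3[of "z ^ m" "of_real (c ^ m)"] unfolding n by (auto simp: max_def min_def)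
  then show "max ?w c ^ m * (1 - (min ?w c / max ?w c) ^ m) \<le> cmod (z ^ m - of_real (c ^ m))"
    by (simp add: right_diff_distrib e)
  have "cmod (z ^ m - of_real (c ^ m)) \<le> max ?w c ^ m + min ?w c ^ m"
    using norm_triangle_ineq4[of "z ^ m" "of_real (c ^ m)"] unfolding n by (auto simp: max_def min_def)
  then show "cmod (z ^ m - of_real (c ^ m)) \<le> max ?w c ^ m * (1 + (min ?w c / max ?w c) ^ m)"
    by (simp add: distrib_left e)
qed

text \<open>
  For \<open>\<bar>z\<bar> \<le> 1\<close> the outer circle of the pair is at least as far away as the inner one, since
  \<open>\<bar>z\<bar> * c \<le> min \<bar>z\<bar> c / max \<bar>z\<bar> c\<close>. Therefore one number \<open>q\<close> controls both factors, and
  the outer circles never have to be estimated separately.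
\<close>

lemma norm_pair_factor_bounds:
  fixes z :: complex
  assumes "0 < c" "c \<le> 1" "cmod z \<le> 1" "(min (cmod z) c / max (cmod z) c) ^ m \<le> q" "q \<le> 1"
  shows "max 1 (cmod z / c) ^ m * (1 - q)\<^sup>2 \<le> cmod (poly (pair_factor m c) z)"
    and "cmod (poly (pair_factor m c) z) \<le> max 1 (cmod z / c) ^ m * (1 + q)\<^sup>2"
proof -
  let ?w = "cmod z"
  let ?A = "max ?w c" and ?a = "min ?w c"
  have A: "0 < ?A" "?A \<le> 1" "0 \<le> ?a" using assms by auto
  have c': "0 < 1 / c" "1 \<le> 1 / c" using assms by auto
  have mx: "max ?w (1 / c) = 1 / c" and mn: "min ?w (1 / c) = ?w" using assms(3) c' by linarith+
  have wc: "?w / (1 / c) = ?a * ?A" by (auto simp: min_def max_def)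
  have "?a * ?A \<le> ?a / ?A"
  proof -
    have "?a * ?A * ?A \<le> ?a * 1 * 1" using A by (intro mult_mono) auto
    then show ?thesis using A by (simp add: pos_le_divide_eq)
  qed
  then have "(?a * ?A) ^ m \<le> (?a / ?A) ^ m" using A by (intro power_mono) auto
  with assms(4) have q2: "(?w / (1 / c)) ^ m \<le> q" unfolding wc by linarith
  have "0 \<le> (?a / ?A) ^ m" using A by (intro zero_le_power divide_nonneg_pos)
  with assms(4) have q0: "0 \<le> q" by linarith
  note b1 = norm_power_diff_bounds[OF assms(1), of z m]
  note b2 = norm_power_diff_bounds[OF c'(1), of z m, unfolded mx mn power_one_over]
  let ?f = "cmod (z ^ m - of_real (c ^ m))" and ?g = "cmod (z ^ m - of_real (1 / c ^ m))"
  have fg: "cmod (poly (pair_factor m c) z) = ?f * ?g" by (simp add: poly_pair_factor norm_mult)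
  have mm: "?A ^ m * (1 / c ^ m) = max 1 (?w / c) ^ m"
  proof -
    have "?A * (1 / c) = max 1 (?w / c)" using assms by (auto simp: max_def field_simps)
    then show ?thesis by (metis power_mult_distrib power_one_over)
  qed
  have Am: "0 \<le> ?A ^ m" using A by (intro zero_le_power) linarith
  have f1: "?A ^ m * (1 - q) \<le> ?f"
    using b1(1) mult_left_mono[OF assms(4) Am] unfolding right_diff_distrib by linarith
  have f2: "?f \<le> ?A ^ m * (1 + q)"
    using b1(2) mult_left_mono[OF assms(4) Am] unfolding distrib_left by linarith
  have cm: "0 \<le> 1 / c ^ m" using assms by simp
  have g1: "1 / c ^ m * (1 - q) \<le> ?g"
    using b2(1) mult_left_mono[OF q2 cm] by (simp add: power_one_over right_diff_distrib)
  have g2: "?g \<le> 1 / c ^ m * (1 + q)"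
    using b2(2) mult_left_mono[OF q2 cm] by (simp add: power_one_over distrib_left)
  have "max 1 (?w / c) ^ m * (1 - q)\<^sup>2 = (?A ^ m * (1 - q)) * (1 / c ^ m * (1 - q))"
    unfolding mm[symmetric] by (simp only: power2_eq_square mult_ac)
  also have "\<dots> \<le> ?f * ?g" by (rule mult_mono[OF f1 g1]) (use assms(5) cm in simp_all)
  finally show "max 1 (?w / c) ^ m * (1 - q)\<^sup>2 \<le> cmod (poly (pair_factor m c) z)" unfolding fg .
  have "?f * ?g \<le> (?A ^ m * (1 + q)) * (1 / c ^ m * (1 + q))"
    by (rule mult_mono[OF f2 g2]) (use q0 Am in simp_all)
  also have "\<dots> = max 1 (?w / c) ^ m * (1 + q)\<^sup>2"
    unfolding mm[symmetric] by (simp only: power2_eq_square mult_ac)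
  finally show "cmod (poly (pair_factor m c) z) \<le> max 1 (?w / c) ^ m * (1 + q)\<^sup>2" unfolding fg .
qed

text \<open>
  In the closed unit disc a pair factor vanishes on its inner circle only; there its outer factor
  has the constant modulus \<open>1 / c ^ m - c ^ m\<close>.
\<close>

lemma pair_factor_inner_zero:
  fixes z :: complex
  assumes m: "0 < m" and c: "0 < c" "c < 1" and z: "cmod z \<le> 1" "poly (pair_factor m c) z = 0"
  shows "cmod z = c"
    and "cmod (poly (pderiv (pair_factor m c)) z) = real m / c * (1 - c ^ (2 * m))"
proof -
  have cm: "0 < c ^ m" "c ^ m < 1" using c m by (auto simp: power_less_one_iff)
  have "z ^ m \<noteq> of_real (1 / c ^ m)"
  proof
    assume "z ^ m = of_real (1 / c ^ m)"
    then have "cmod z ^ m = cmod (of_real (1 / c ^ m))" by (simp only: norm_power[symmetric])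
    also have "\<dots> = 1 / c ^ m" using cm by (simp only: norm_of_real) simp
    finally have "cmod z ^ m = 1 / c ^ m" .
    moreover have "cmod z ^ m \<le> 1" using z by (simp add: power_le_one)
    ultimately show False using cm by simp
  qed
  then have eq: "z ^ m = of_real (c ^ m)" using z by (simp add: poly_pair_factor)
  then have "cmod z ^ m = cmod (of_real (c ^ m))" by (simp only: norm_power[symmetric])
  also have "\<dots> = c ^ m" using cm by (simp only: norm_of_real abs_of_pos)
  finally have n: "cmod z ^ m = c ^ m" .
  then show w: "cmod z = c" using power_eq_imp_eq_base[of "cmod z" m c] c m by simp
  let ?A = "monom 1 m - [:complex_of_real (c ^ m):]"
  let ?B = "monom 1 m - [:complex_of_real (1 / c ^ m):]"
  have "poly (pderiv (pair_factor m c)) z = poly ?B z * (of_nat m * z ^ (m - 1))"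
    using eq by (simp add: pair_factor_def pderiv_mult pderiv_diff pderiv_monom pderiv_pCons poly_monom)
  also have "poly ?B z = of_real (c ^ m - 1 / c ^ m)" using eq by (simp add: poly_monom)
  also have "cmod (of_real (c ^ m - 1 / c ^ m) * (of_nat m * z ^ (m - 1)))
      = \<bar>c ^ m - 1 / c ^ m\<bar> * (real m * c ^ (m - 1))"
    by (simp only: norm_mult norm_of_real norm_of_nat norm_power w)
  also have "\<bar>c ^ m - 1 / c ^ m\<bar> = (1 - c ^ (2 * m)) / c ^ m"
  proof -
    have "c ^ m - 1 / c ^ m = - ((1 - c ^ (2 * m)) / c ^ m)"
    proof -
      have "u - 1 / u = - ((1 - u * u) / u)" if "0 < u" for u :: real
        using that by (simp add: field_simps)
      then show ?thesis using cm by (simp add: mult_2 power_add)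
    qed
    moreover have "0 \<le> (1 - c ^ (2 * m)) / c ^ m" using c by (simp add: power_le_one)
    ultimately show ?thesis by linarith
  qed
  also have "(1 - c ^ (2 * m)) / c ^ m * (real m * c ^ (m - 1)) = real m / c * (1 - c ^ (2 * m))"
  proof -
    have "c ^ m = c * c ^ (m - 1)" using m by (cases m) auto
    then show ?thesis using c by simp
  qed
  finally show "cmod (poly (pderiv (pair_factor m c)) z) = real m / c * (1 - c ^ (2 * m))" .
qed

section \<open>Circles with linearly growing gaps and multiplicities\<close>

lemma sum_power_inj_le_geometric:
  fixes \<theta> :: real
  assumes "finite A" "inj_on f A" "0 \<le> \<theta>" "\<theta> < 1"
  shows "(\<Sum>k\<in>A. \<theta> ^ f k) \<le> 1 / (1 - \<theta>)"
proof -
  have "(\<Sum>k\<in>A. \<theta> ^ f k) = (\<Sum>i\<in>f ` A. \<theta> ^ i)"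
    using assms(2) by (simp add: sum.reindex)
  also have "\<dots> \<le> (\<Sum>i. \<theta> ^ i)"
    using assms by (intro sum_le_suminf summable_geometric) auto
  also have "\<dots> = 1 / (1 - \<theta>)" using assms by (intro suminf_geometric) auto
  finally show ?thesis .
qed

lemma prod_one_plus_le_exp:
  fixes e :: "'a \<Rightarrow> real"
  assumes "\<And>k. k \<in> A \<Longrightarrow> 0 \<le> e k" "(\<Sum>k\<in>A. e k) \<le> B"
  shows "(\<Prod>k\<in>A. 1 + e k) \<le> exp B"
proof (cases "finite A")
  case True
  have "(\<Prod>k\<in>A. 1 + e k) \<le> (\<Prod>k\<in>A. exp (e k))"
    using assms by (intro prod_mono) (auto simp: add_nonneg_nonneg)
  also have "\<dots> = exp (\<Sum>k\<in>A. e k)" using True by (simp add: exp_sum)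
  finally show ?thesis using assms(2) by (simp add: order_trans)
next
  case False
  then show ?thesis using assms by simp
qed

text \<open>
  This follows from \<open>1 / (1 - e) = 1 + e / (1 - e) \<le> exp (e / (1 - \<theta>))\<close> for \<open>0 \<le> e \<le> \<theta>\<close>.
\<close>

lemma prod_one_minus_ge_exp:
  fixes e :: "'a \<Rightarrow> real"
  assumes "\<And>k. k \<in> A \<Longrightarrow> 0 \<le> e k" "\<And>k. k \<in> A \<Longrightarrow> e k \<le> \<theta>" "\<theta> < 1" "(\<Sum>k\<in>A. e k) \<le> B"
  shows "exp (- (B / (1 - \<theta>))) \<le> (\<Prod>k\<in>A. 1 - e k)"
proof (cases "finite A")
  case True
  have "exp (- (B / (1 - \<theta>))) \<le> exp (\<Sum>k\<in>A. - (e k / (1 - \<theta>)))"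
    using assms by (simp add: sum_negf sum_divide_distrib[symmetric] divide_right_mono)
  also have "\<dots> = (\<Prod>k\<in>A. exp (- (e k / (1 - \<theta>))))" using True by (simp add: exp_sum)
  also have "\<dots> \<le> (\<Prod>k\<in>A. 1 - e k)"
  proof (rule prod_mono)
    fix k assume k: "k \<in> A"
    have e: "0 \<le> e k" "e k \<le> \<theta>" using assms k by auto
    have "1 / (1 - e k) = 1 + e k / (1 - e k)" using e assms(3) by (simp add: field_simps)
    also have "\<dots> \<le> 1 + e k / (1 - \<theta>)" using e assms(3) by (simp add: frac_le)
    also have "\<dots> \<le> exp (e k / (1 - \<theta>))" by (rule exp_ge_add_one_self)
    finally have "inverse (exp (e k / (1 - \<theta>))) \<le> inverse (1 / (1 - e k))"
      using e assms(3) by (intro le_imp_inverse_le) auto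
    then show "0 \<le> exp (- (e k / (1 - \<theta>))) \<and> exp (- (e k / (1 - \<theta>))) \<le> 1 - e k"
      by (simp add: exp_minus)
  qed
  finally show ?thesis .
next
  case False
  then show ?thesis using assms by simp
qed

text \<open>
  Circle number \<open>k\<close> lies at coordinate \<open>y k\<close> and carries \<open>m k\<close> zeros; gaps and multiplicities are
  comparable to \<open>k\<close>. The case \<open>m k = 0\<close> covers the factors that are removed from the product,
  and \<open>y 0 = 0\<close> is the pole, which is not a circle.
\<close>

locale spaced_circles =
  fixes \<alpha> \<beta> :: real and y :: "nat \<Rightarrow> real" and m :: "nat \<Rightarrow> nat" and K :: nat
  assumes alpha_pos: "0 < \<alpha>"
    and y_0: "y 0 = 0"
    and gap_ge: "k < K \<Longrightarrow> \<alpha> * real (Suc k) \<le> y (Suc k) - y k"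
    and gap_le: "k < K \<Longrightarrow> y (Suc k) - y k \<le> \<beta> * real (Suc k)"
    and mult_ge: "1 \<le> k \<Longrightarrow> k \<le> K \<Longrightarrow> m k = 0 \<or> \<alpha> * real k \<le> real (m k)"
    and K_pos: "0 < K"
begin

lemma beta_pos: "0 < \<beta>"
  using gap_ge[of 0] gap_le[of 0] K_pos alpha_pos by simp

text \<open>
  The \<open>k - p\<close> gaps from circle \<open>p\<close> to circle \<open>k\<close> are at least \<open>\<alpha> * (p + 1), \<dots>, \<alpha> * k\<close>, and the
  mean of these numbers is at least \<open>\<alpha> * k / 2\<close>.
\<close>

lemma y_diff_ge: "p \<le> k \<Longrightarrow> k \<le> K \<Longrightarrow> \<alpha> * (real k - real p) * real k / 2 \<le> y k - y p"
proof (induction k rule: dec_induct)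
  case (step k)
  have "\<alpha> * (real (Suc k) - real p) * real (Suc k) / 2
      = \<alpha> * (real k - real p) * real k / 2 + \<alpha> * real (Suc k) - \<alpha> * (1 + real p) / 2"
    by (simp add: field_simps)
  also have "\<dots> \<le> (y k - y p) + (y (Suc k) - y k)"
  proof -
    have "0 \<le> \<alpha> * (1 + real p) / 2" using alpha_pos by simp
    then show ?thesis using step gap_ge[of k] by linarith
  qed
  finally show ?case by simp
qed simp

lemma y_le: "k \<le> K \<Longrightarrow> y k \<le> \<beta> * (real k)\<^sup>2"
proof (induction k)
  case (Suc k)
  have "y (Suc k) \<le> \<beta> * (real k)\<^sup>2 + \<beta> * real (Suc k)"
    using Suc gap_le[of k] by simp
  also have "\<dots> \<le> \<beta> * (real (Suc k))\<^sup>2"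
    using beta_pos by (simp add: power2_eq_square algebra_simps)
  finally show ?case .
qed (simp add: y_0)

lemma y_mono: "p \<le> k \<Longrightarrow> k \<le> K \<Longrightarrow> y p \<le> y k"
proof -
  assume a: "p \<le> k" "k \<le> K"
  then have "0 \<le> \<alpha> * (real k - real p) * real k / 2" using alpha_pos by simp
  then show "y p \<le> y k" using y_diff_ge[of p k] a by simp
qed

lemma y_strict: "p < k \<Longrightarrow> k \<le> K \<Longrightarrow> y p < y k"
proof -
  assume a: "p < k" "k \<le> K"
  then have "0 < \<alpha> * (real k - real p) * real k / 2" using alpha_pos by simp
  then show "y p < y k" using y_diff_ge[of p k] a by simp
qed

lemma y_pos: "1 \<le> k \<Longrightarrow> k \<le> K \<Longrightarrow> 0 < y k"
  using y_strict[of 0 k] y_0 by simp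

lemma y_nonneg: "k \<le> K \<Longrightarrow> 0 \<le> y k"
  using y_mono[of 0 k] y_0 by simp

text \<open>
  The relative distance from circle \<open>p\<close> to circle \<open>k\<close> is at least of order \<open>(k - p) / k\<close>, because
  \<open>y k\<close> is of order \<open>k\<^sup>2\<close> and the distance at least of order \<open>(k - p) * k\<close>.
\<close>

lemma y_ratio_le:
  assumes "p \<le> k" "1 \<le> k" "k \<le> K"
  shows "y p / y k \<le> exp (- (\<alpha> / (2 * \<beta>) * ((real k - real p) / real k)))"
proof -
  have yk: "0 < y k" using y_pos assms by simp
  have "\<alpha> / (2 * \<beta>) * ((real k - real p) / real k)
      = (\<alpha> * (real k - real p) * real k / 2) / (\<beta> * (real k)\<^sup>2)"
    using assms beta_pos by (simp add: power2_eq_square field_simps)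
  also have "\<dots> \<le> (y k - y p) / y k"
    using y_diff_ge[of p k] y_le[of k] yk y_mono[of p k] assms alpha_pos
    by (intro frac_le) auto
  also have "\<dots> = 1 - y p / y k" using yk by (simp add: diff_divide_distrib)
  finally have "y p / y k \<le> 1 + - (\<alpha> / (2 * \<beta>) * ((real k - real p) / real k))" by simp
  also have "\<dots> \<le> exp (- (\<alpha> / (2 * \<beta>) * ((real k - real p) / real k)))"
    by (rule exp_ge_add_one_self)
  finally show ?thesis .
qed

text \<open>
  The exponential rate at which the influence of a circle decays per circle in between.
\<close>

definition \<gamma> :: real where "\<gamma> = \<alpha>\<^sup>2 / (4 * \<beta>)"

text \<open>
  The ratio of the dominating geometric series; halving \<open>\<gamma>\<close> pays for the circles that are closer
  to the pole than the point considered.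
\<close>

definition \<theta> :: real where "\<theta> = exp (- (\<gamma> / 2))"

lemma gamma_pos: "0 < \<gamma>" using alpha_pos beta_pos by (simp add: \<gamma>_def)

lemma theta: "0 < \<theta>" "\<theta> < 1" using gamma_pos by (auto simp: \<theta>_def)

text \<open>
  An upper bound for \<open>q ^ m\<close>, where \<open>q\<close> is the quotient of the radii belonging to \<open>x\<close> and
  \<open>y k\<close>: those radii are \<open>sqrt (x / (N - x))\<close>, and on the hemisphere \<open>x \<le> N / 2\<close> dropping
  the denominators only increases the quotient of the smaller by the larger one. An absent
  circle has no influence.
\<close>

definition influence :: "real \<Rightarrow> nat \<Rightarrow> real" where
  "influence x k = (if m k = 0 then 0 else sqrt (min x (y k) / max x (y k)) ^ m k)"

lemma influence_nonneg: "0 \<le> x \<Longrightarrow> k \<le> K \<Longrightarrow> 0 \<le> influence x k"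
  using y_nonneg[of k] by (auto simp: influence_def min_def max_def)

lemma influence_le_1: "0 \<le> x \<Longrightarrow> k \<le> K \<Longrightarrow> influence x k \<le> 1"
proof -
  assume a: "0 \<le> x" "k \<le> K"
  then have "0 \<le> min x (y k) / max x (y k)" "min x (y k) / max x (y k) \<le> 1"
    using y_nonneg[of k] by (auto simp: min_def max_def divide_le_eq)
  then have "sqrt (min x (y k) / max x (y k)) ^ m k \<le> 1" by (intro power_le_one) auto
  then show "influence x k \<le> 1" by (simp add: influence_def)
qed

lemma sqrt_power_le_exp:
  assumes "0 \<le> a" "a \<le> exp (- u)" "u * real n / 2 \<ge> v"
  shows "sqrt a ^ n \<le> exp (- v)"
proof -
  have "sqrt a \<le> sqrt (exp (- u))" using assms by simp
  also have "\<dots> = exp (- u / 2)"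
  proof (rule real_sqrt_unique)
    show "(exp (- u / 2))\<^sup>2 = exp (- u)" by (simp flip: exp_double)
  qed simp
  finally have "sqrt a ^ n \<le> exp (- u / 2) ^ n" using assms by (intro power_mono) auto
  also have "\<dots> = exp (- (u * real n / 2))" by (simp add: exp_of_nat_mult[symmetric])
  also have "\<dots> \<le> exp (- v)" using assms by simp
  finally show ?thesis .
qed

text \<open>
  The factor \<open>k\<close> in the multiplicity cancels the \<open>k\<close> in the denominator of \<open>y_ratio_le\<close>.
\<close>

lemma influence_above:
  assumes "p \<le> k" "1 \<le> k" "k \<le> K" "0 \<le> x" "x \<le> y p"
  shows "influence x k \<le> exp (- (\<gamma> * (real k - real p)))"
proof (cases "m k = 0")
  case False
  have yk: "0 < y k" using y_pos assms by simp
  have x: "x \<le> y k" using assms y_mono[of p k] by simp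
  have "x / y k \<le> y p / y k" using assms yk by (simp add: divide_right_mono)
  also note y_ratio_le[OF assms(1-3)]
  finally have *: "x / y k \<le> exp (- (\<alpha> / (2 * \<beta>) * ((real k - real p) / real k)))" .
  have "\<gamma> * (real k - real p) = \<alpha> / (2 * \<beta>) * ((real k - real p) / real k) * (\<alpha> * real k) / 2"
    using assms beta_pos by (simp add: \<gamma>_def power2_eq_square)
  also have "\<dots> \<le> \<alpha> / (2 * \<beta>) * ((real k - real p) / real k) * real (m k) / 2"
    using mult_ge[of k] False assms alpha_pos beta_pos
    by (intro divide_right_mono mult_left_mono) auto
  finally have "sqrt (x / y k) ^ m k \<le> exp (- (\<gamma> * (real k - real p)))"
    using assms yk by (intro sqrt_power_le_exp[OF _ *]) auto
  then show ?thesis using False x by (simp add: influence_def min_absorb1 max_absorb2)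
qed (simp add: influence_def)

text \<open>
  Circles closer to the pole carry fewer zeros, hence the exponent \<open>k * (p - k) / p\<close> in place
  of \<open>p - k\<close>. It is small at both ends of the range of \<open>k\<close> but grows linearly away from them.
\<close>

lemma influence_below:
  assumes "k \<le> p" "1 \<le> k" "p \<le> K" "y p \<le> x"
  shows "influence x k \<le> exp (- (\<gamma> * (real k * (real p - real k) / real p)))"
proof (cases "m k = 0")
  case False
  have yp: "0 < y p" and yk: "0 < y k" using y_pos assms by simp_all
  have x: "y k \<le> x" using assms y_mono[of k p] by simp
  have "y k / x \<le> y k / y p" using assms yk yp by (intro divide_left_mono) auto
  also have "\<dots> \<le> exp (- (\<alpha> / (2 * \<beta>) * ((real p - real k) / real p)))"
    using assms by (intro y_ratio_le) auto
  finally have *: "y k / x \<le> exp (- (\<alpha> / (2 * \<beta>) * ((real p - real k) / real p)))" .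
  have "\<gamma> * (real k * (real p - real k) / real p)
      = \<alpha> / (2 * \<beta>) * ((real p - real k) / real p) * (\<alpha> * real k) / 2"
    using assms beta_pos by (simp add: \<gamma>_def power2_eq_square mult_ac)
  also have "\<dots> \<le> \<alpha> / (2 * \<beta>) * ((real p - real k) / real p) * real (m k) / 2"
    using mult_ge[of k] False assms alpha_pos beta_pos
    by (intro divide_right_mono mult_left_mono) auto
  finally have "sqrt (y k / x) ^ m k \<le> exp (- (\<gamma> * (real k * (real p - real k) / real p)))"
    using assms yk yp by (intro sqrt_power_le_exp[OF _ *]) auto
  then show ?thesis using False x by (simp add: influence_def min_absorb2 max_absorb1)
qed (simp add: influence_def)

lemma theta_power: "\<theta> ^ n = exp (- (\<gamma> * real n / 2))"
  by (simp add: \<theta>_def exp_of_nat_mult[symmetric] mult_ac)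

text \<open>
  The exponent \<open>k * (p - k) / p\<close> is at least half of the smaller one of \<open>k\<close> and \<open>p - k\<close>, because
  the other one is at least \<open>p / 2\<close>.
\<close>

lemma influence_below':
  assumes "k \<le> p" "1 \<le> k" "p \<le> K" "y p \<le> x"
  shows "influence x k \<le> \<theta> ^ (min k (p - k))"
proof -
  have p: "0 < real p" using assms by simp
  have "real (min k (p - k)) / 2 * real p \<le> real k * (real p - real k)"
  proof (cases "2 * k \<le> p")
    case True
    then have "real k * (real p / 2) \<le> real k * (real p - real k)" by (intro mult_left_mono) auto
    then show ?thesis using True by (simp add: min_def)
  next
    case False
    then have "real p / 2 * (real p - real k) \<le> real k * (real p - real k)"
      using assms by (intro mult_right_mono) auto
    moreover have "real (min k (p - k)) = real p - real k" using False assms by (simp add: min_def)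
    ultimately show ?thesis by (simp add: mult_ac)
  qed
  then have "real (min k (p - k)) / 2 \<le> real k * (real p - real k) / real p"
    using p by (simp add: pos_le_divide_eq)
  then have "\<gamma> * (real (min k (p - k)) / 2) \<le> \<gamma> * (real k * (real p - real k) / real p)"
    using gamma_pos by (intro mult_left_mono) auto
  then have "exp (- (\<gamma> * (real k * (real p - real k) / real p))) \<le> \<theta> ^ (min k (p - k))"
    unfolding theta_power by simp
  then show ?thesis using influence_below[OF assms] by linarith
qed

lemma influence_above':
  assumes "p \<le> k" "1 \<le> k" "k \<le> K" "0 \<le> x" "x \<le> y p"
  shows "influence x k \<le> \<theta> ^ (k - p)"
proof -
  have "\<gamma> * real (k - p) / 2 \<le> \<gamma> * (real k - real p)"
    using gamma_pos assms by (simp add: of_nat_diff)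
  then have "exp (- (\<gamma> * (real k - real p))) \<le> \<theta> ^ (k - p)" unfolding theta_power by simp
  then show ?thesis using influence_above[OF assms] by linarith
qed

lemma influence_at_node:
  assumes "1 \<le> p" "p \<le> K" "1 \<le> k" "k \<le> K" "k \<noteq> p"
  shows "influence (y p) k \<le> \<theta>"
proof (cases "k < p")
  case True
  then have "\<theta> ^ (min k (p - k)) \<le> \<theta> ^ 1"
    using assms theta by (intro power_decreasing) auto
  then show ?thesis using influence_below'[of k p "y p"] True assms by simp
next
  case False
  then have "\<theta> ^ (k - p) \<le> \<theta> ^ 1" using assms theta by (intro power_decreasing) auto
  then show ?thesis using influence_above'[of p k "y p"] False assms y_nonneg[of p] by simp
qed

lemma find_segment:
  assumes "0 < x" "x \<le> y K"
  obtains p where "p < K" "y p \<le> x" "x \<le> y (Suc p)"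
proof -
  define p where "p = (LEAST q. x \<le> y (Suc q))"
  have ex: "x \<le> y (Suc (K - 1))" using assms K_pos by simp
  have p1: "x \<le> y (Suc p)" unfolding p_def using ex by (rule LeastI)
  have p2: "p \<le> K - 1" unfolding p_def using ex by (rule Least_le)
  have "y p \<le> x"
  proof (cases p)
    case 0
    then show ?thesis using y_0 assms by simp
  next
    case (Suc q)
    then have "\<not> x \<le> y (Suc q)" using not_less_Least[of q "\<lambda>q. x \<le> y (Suc q)"] unfolding p_def by auto
    then show ?thesis using Suc by simp
  qed
  then show ?thesis using that[of p] p1 p2 K_pos by auto
qed

text \<open>
  If \<open>x\<close> lies between circles \<open>p\<close> and \<open>p + 1\<close>, three geometric series dominate: in \<open>k\<close> and in
  \<open>p - k\<close> for the circles up to \<open>p\<close>, and in \<open>k - (p + 1)\<close> for those beyond.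
\<close>

lemma influence_sum:
  assumes "0 < x" "x \<le> y K"
  shows "(\<Sum>k=1..K. influence x k) \<le> 3 / (1 - \<theta>)"
proof -
  obtain p where p: "p < K" "y p \<le> x" "x \<le> y (Suc p)" using find_segment[OF assms] .
  have split: "{1..K} = {1..p} \<union> {Suc p..K}" using p by auto
  have "(\<Sum>k=1..p. influence x k) \<le> (\<Sum>k=1..p. \<theta> ^ k + \<theta> ^ (p - k))"
  proof (rule sum_mono)
    fix k assume k: "k \<in> {1..p}"
    have "influence x k \<le> \<theta> ^ (min k (p - k))" using influence_below'[of k p x] k p by simp
    also have "\<dots> \<le> \<theta> ^ k + \<theta> ^ (p - k)" using theta by (simp add: min_def)
    finally show "influence x k \<le> \<theta> ^ k + \<theta> ^ (p - k)" .
  qed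
  also have "\<dots> = (\<Sum>k=1..p. \<theta> ^ k) + (\<Sum>k=1..p. \<theta> ^ (p - k))" by (rule sum.distrib)
  also have "\<dots> \<le> 1 / (1 - \<theta>) + 1 / (1 - \<theta>)"
    using theta by (intro add_mono sum_power_inj_le_geometric) (auto simp: inj_on_def)
  finally have 1: "(\<Sum>k=1..p. influence x k) \<le> 2 / (1 - \<theta>)" by simp
  have "(\<Sum>k=Suc p..K. influence x k) \<le> (\<Sum>k=Suc p..K. \<theta> ^ (k - Suc p))"
    using p assms by (intro sum_mono influence_above') auto
  also have "\<dots> \<le> 1 / (1 - \<theta>)"
    using theta by (intro sum_power_inj_le_geometric) (auto simp: inj_on_def)
  finally have 2: "(\<Sum>k=Suc p..K. influence x k) \<le> 1 / (1 - \<theta>)" .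
  have "(\<Sum>k=1..K. influence x k) = (\<Sum>k=1..p. influence x k) + (\<Sum>k=Suc p..K. influence x k)"
    unfolding split by (rule sum.union_disjoint) auto
  also have "\<dots> \<le> 2 / (1 - \<theta>) + 1 / (1 - \<theta>)" using 1 2 by (rule add_mono)
  also have "\<dots> = 3 / (1 - \<theta>)" by (simp add: add_divide_distrib[symmetric])
  finally show ?thesis .
qed

end

section \<open>Logarithmic integrals and Simpson's rule\<close>

lemma ln_one_minus_bounds:
  fixes u :: real
  assumes "0 \<le> u" "u < 1"
  shows "- (u / (1 - u)) \<le> ln (1 - u)" "ln (1 - u) \<le> - u"
proof -
  have "ln (1 / (1 - u)) \<le> 1 / (1 - u) - 1" using assms by (intro ln_le_minus_one) auto
  also have "1 / (1 - u) - 1 = u / (1 - u)" using assms by (simp add: field_simps)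
  finally show "- (u / (1 - u)) \<le> ln (1 - u)" using assms by (simp add: ln_div)
  show "ln (1 - u) \<le> - u" using ln_le_minus_one[of "1 - u"] assms by simp
qed

text \<open>
  The expression between the bars is the error of Simpson's rule for the logarithm on \<open>[1 - e, 1 + e]\<close>. Its
  derivative is \<open>2/3 * (ln (1 - e\<^sup>2) + e\<^sup>2 / (1 - e\<^sup>2))\<close>, in which the terms of order \<open>e\<^sup>2\<close> cancel:
  that is the effect of the weights 1 : 4 : 1.
\<close>

lemma simpson_kernel:
  fixes e :: real
  assumes "0 < e" "e < 1"
  shows "\<bar>(1 + 2 * e / 3) * ln (1 + e) - (1 - 2 * e / 3) * ln (1 - e) - 2 * e\<bar> \<le> e ^ 5 / (1 - e)"
proof -
  define g where "g = (\<lambda>e::real. (1 + 2 * e / 3) * ln (1 + e) - (1 - 2 * e / 3) * ln (1 - e) - 2 * e)"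
  define g' where "g' = (\<lambda>e::real. 2 / 3 * (ln (1 - e\<^sup>2) + e\<^sup>2 / (1 - e\<^sup>2)))"
  have "(g has_real_derivative g' x) (at x)" if "0 \<le> x" "x \<le> e" for x
  proof -
    have x: "0 \<le> x" "x < 1" using that assms by auto
    have D: "(g has_real_derivative
        (2 / 3 * ln (1 + x) + (1 + 2 * x / 3) * (1 / (1 + x))
          - (- 2 / 3 * ln (1 - x) + (1 - 2 * x / 3) * (- 1 / (1 - x))) - 2)) (at x)"
      unfolding g_def using x by (auto intro!: derivative_eq_intros)
    have l: "ln (1 - x\<^sup>2) = ln (1 + x) + ln (1 - x)"
      using x by (subst ln_mult_pos[symmetric]) (auto simp: power2_eq_square algebra_simps)
    have r: "(1 + 2 * x / 3) * (1 / (1 + x)) - (1 - 2 * x / 3) * (- 1 / (1 - x)) - 2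
        = 2 / 3 * (x\<^sup>2 / (1 - x\<^sup>2))"
    proof -
      have f: "1 - x\<^sup>2 = (1 + x) * (1 - x)" by (simp add: power2_eq_square algebra_simps)
      show ?thesis unfolding f using x by (simp add: divide_simps) algebra
    qed
    have "2 / 3 * a + A - (- 2 / 3 * b + B) - 2 = 2 / 3 * (a + b + q)"
      if "A - B - 2 = 2 / 3 * q" for a b A B q :: real
      using that by (simp add: field_simps)
    from DERIV_cong[OF D this[OF r]] show ?thesis unfolding g'_def l .
  qed
  then obtain \<xi> where \<xi>: "0 < \<xi>" "\<xi> < e" and eq: "g e - g 0 = (e - 0) * g' \<xi>"
    using MVT2[of 0 e g g'] assms by blast
  have u: "0 \<le> \<xi>\<^sup>2" "\<xi>\<^sup>2 < 1" using \<xi> assms by (auto simp: power_less_one_iff)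
  have "0 \<le> g' \<xi>" unfolding g'_def using ln_one_minus_bounds(1)[OF u] by simp
  have "g' \<xi> \<le> 2 / 3 * (- \<xi>\<^sup>2 + \<xi>\<^sup>2 / (1 - \<xi>\<^sup>2))"
    unfolding g'_def using ln_one_minus_bounds(2)[OF u] by simp
  also have "- \<xi>\<^sup>2 + \<xi>\<^sup>2 / (1 - \<xi>\<^sup>2) = \<xi> ^ 4 / (1 - \<xi>\<^sup>2)"
    using u by (simp add: field_simps flip: power_add)
  also have "2 / 3 * (\<xi> ^ 4 / (1 - \<xi>\<^sup>2)) \<le> 1 * (\<xi> ^ 4 / (1 - \<xi>\<^sup>2))"
    using u by (intro mult_right_mono) auto
  also have "\<dots> \<le> e ^ 4 / (1 - e)"
  proof -
    have "\<xi> * \<xi> \<le> e * 1" using \<xi> assms by (intro mult_mono) auto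
    then have "\<xi>\<^sup>2 \<le> e" by (simp add: power2_eq_square)
    moreover have "\<xi> ^ 4 \<le> e ^ 4" using \<xi> by (intro power_mono) auto
    ultimately show ?thesis unfolding mult_1 using assms by (intro frac_le) auto
  qed
  finally have "g' \<xi> \<le> e ^ 4 / (1 - e)" .
  then have "e * g' \<xi> \<le> e * (e ^ 4 / (1 - e))" using assms by (intro mult_left_mono) auto
  moreover have "g e = e * g' \<xi>" using eq by (simp add: g_def)
  moreover have "0 \<le> e * g' \<xi>" using \<open>0 \<le> g' \<xi>\<close> assms by simp
  ultimately have "\<bar>g e\<bar> \<le> e * (e ^ 4 / (1 - e))" by simp
  also have "\<dots> = e ^ 5 / (1 - e)" by (simp add: numeral_eq_Suc)
  finally show ?thesis unfolding g_def .
qed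

text \<open>
  The expression between the bars is the error of a quadrature rule for the logarithm on
  \<open>[c - d, c + d]\<close>, with weight \<open>s\<close> at each end and \<open>2 * d - 2 * s\<close> at the midpoint: that is, a band
  with \<open>2 * d\<close> zeros compared with the uniform distribution. For \<open>s = d / 3\<close> it is Simpson's rule
  and equals \<open>c\<close> times the expression of \<open>simpson_kernel\<close> at \<open>e = d / c\<close>; the deviation of \<open>s\<close> from
  \<open>d / 3\<close> is at most \<open>5 / 6\<close> and enters with the factor \<open>ln (1 - (d / c)\<^sup>2)\<close>.
\<close>

lemma simpson_log:
  fixes c d s :: real
  assumes "0 < d" "d < c" "\<bar>2 * d - 6 * s\<bar> \<le> 5"
  shows "\<bar>(c - d + s) * (ln c - ln (c - d)) + (c + d - s) * (ln (c + d) - ln c) - 2 * d\<bar>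
       \<le> (d ^ 5 / c ^ 4 + d\<^sup>2 / c\<^sup>2) / (1 - d / c)"
proof -
  define e where "e = d / c"
  have c: "0 < c" using assms by simp
  have e: "0 < e" "e < 1" using assms c by (auto simp: e_def)
  have d: "d = c * e" using c by (simp add: e_def)
  have l1: "ln (c - d) = ln c + ln (1 - e)"
    using c e by (subst ln_mult_pos[symmetric]) (auto simp: d algebra_simps)
  have l2: "ln (c + d) = ln c + ln (1 + e)"
    using c e by (subst ln_mult_pos[symmetric]) (auto simp: d algebra_simps)
  have l3: "ln (1 - e\<^sup>2) = ln (1 + e) + ln (1 - e)"
    using e by (subst ln_mult_pos[symmetric]) (auto simp: power2_eq_square algebra_simps)
  have "(c - d + s) * (ln c - ln (c - d)) + (c + d - s) * (ln (c + d) - ln c) - 2 * d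
      = c * ((1 + 2 * e / 3) * ln (1 + e) - (1 - 2 * e / 3) * ln (1 - e) - 2 * e)
        + (d / 3 - s) * ln (1 - e\<^sup>2)"
    unfolding l1 l2 l3 by (simp add: d field_simps)
  also have "\<bar>\<dots>\<bar> \<le> c * (e ^ 5 / (1 - e)) + 1 * (e\<^sup>2 / (1 - e))"
  proof -
    have u: "0 \<le> e\<^sup>2" "e\<^sup>2 < 1" using e by (auto simp: power_less_one_iff)
    have e2: "e\<^sup>2 \<le> e" using e by (simp add: power2_eq_square)
    have "\<bar>ln (1 - e\<^sup>2)\<bar> \<le> e\<^sup>2 / (1 - e\<^sup>2)" using ln_one_minus_bounds[OF u] u by linarith
    also have "\<dots> \<le> e\<^sup>2 / (1 - e)" using e2 e u by (intro frac_le) auto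
    finally have "\<bar>(d / 3 - s) * ln (1 - e\<^sup>2)\<bar> \<le> 1 * (e\<^sup>2 / (1 - e))"
      unfolding abs_mult using assms(3) by (intro mult_mono) auto
    moreover have "\<bar>c * ((1 + 2 * e / 3) * ln (1 + e) - (1 - 2 * e / 3) * ln (1 - e) - 2 * e)\<bar>
        \<le> c * (e ^ 5 / (1 - e))"
      unfolding abs_mult using simpson_kernel[OF e] c by (intro mult_mono) auto
    ultimately show ?thesis by linarith
  qed
  also have "\<dots> = (c * e ^ 5 + e\<^sup>2) / (1 - e)" by (simp add: add_divide_distrib)
  also have "c * e ^ 5 = d ^ 5 / c ^ 4" using c by (simp add: e_def power_divide numeral_eq_Suc)
  finally show ?thesis by (simp add: e_def power_divide)
qed

text \<open>
  The derivative of \<open>n * ln x + (N - n) * ln (N - x)\<close> is \<open>N * (n - x) / (x * (N - x))\<close>: it is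
  governed by the discrepancy between the \<open>n\<close> zeros on the polar side of \<open>x\<close> and the \<open>x\<close> zeros
  that a uniform distribution has there.
\<close>

lemma log_segment:
  fixes n N u v D :: real
  assumes "0 < v" "v \<le> u" "u \<le> N / 2" "u - v \<le> D" "\<And>x. v \<le> x \<Longrightarrow> x \<le> u \<Longrightarrow> \<bar>n - x\<bar> \<le> D"
  shows "\<bar>n * (ln u - ln v) + (N - n) * (ln (N - u) - ln (N - v))\<bar> \<le> 2 * D\<^sup>2 / v"
proof (cases "v = u")
  case True
  then show ?thesis using assms by simp
next
  case False
  then have uv: "v < u" using assms by simp
  define f where "f = (\<lambda>x. n * ln x + (N - n) * ln (N - x))"
  have "(f has_real_derivative (n / x - (N - n) / (N - x))) (at x)" if "v \<le> x" "x \<le> u" for x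
    unfolding f_def using that assms uv by (auto intro!: derivative_eq_intros)
  then obtain \<xi> where \<xi>: "v < \<xi>" "\<xi> < u" and eq: "f u - f v = (u - v) * (n / \<xi> - (N - n) / (N - \<xi>))"
    using MVT2[of v u f "\<lambda>x. n / x - (N - n) / (N - x)"] uv by blast
  have pos: "0 < \<xi>" "0 < N - \<xi>" "0 < N" "N / 2 \<le> N - \<xi>" using \<xi> assms by auto
  have "n / \<xi> - (N - n) / (N - \<xi>) = (n - \<xi>) * (N / (\<xi> * (N - \<xi>)))"
    using pos by (simp add: field_simps)
  also have "\<bar>\<dots>\<bar> \<le> D * (N / (v * (N / 2)))"
    unfolding abs_mult
  proof (rule mult_mono)
    show "\<bar>N / (\<xi> * (N - \<xi>))\<bar> \<le> N / (v * (N / 2))"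
    proof -
      have "N / (\<xi> * (N - \<xi>)) \<le> N / (v * (N / 2))"
        using pos \<xi> assms by (intro divide_left_mono mult_mono mult_pos_pos) auto
      then show ?thesis using pos by simp
    qed
    show "\<bar>n - \<xi>\<bar> \<le> D" "0 \<le> D" using assms(5)[of \<xi>] \<xi> by auto
  qed auto
  also have "N / (v * (N / 2)) = 2 / v" using pos by simp
  finally have "\<bar>f u - f v\<bar> \<le> D * (D * (2 / v))"
    unfolding eq abs_mult using assms uv by (intro mult_mono) auto
  moreover have "f u - f v = n * (ln u - ln v) + (N - n) * (ln (N - u) - ln (N - v))"
    by (simp add: f_def algebra_simps)
  ultimately show ?thesis by (simp add: power2_eq_square mult_ac)
qed

section \<open>The radial potential\<close>

text \<open>
  The hypotheses of the theorem for one choice of \<open>N\<close>, \<open>M\<close> and \<open>r\<close>. The bounds defined in this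
  context, up to \<open>cond_const\<close>, mention \<open>C1\<close> and \<open>C2\<close> only; this is what makes the final constant
  uniform.
\<close>

locale band_partition =
  fixes C1 C2 :: real and N M :: nat and r :: "nat \<Rightarrow> nat"
  assumes C1_pos: "0 < C1" and M_ge: "2 \<le> M"
    and r_pos: "1 \<le> j \<Longrightarrow> j \<le> M \<Longrightarrow> 0 < r j"
    and N_eq: "N = r M + 2 * (\<Sum>j=1..M-1. r j)"
    and r_ge: "1 \<le> j \<Longrightarrow> j \<le> M \<Longrightarrow> C1 * real j \<le> real (r j)"
    and r_le: "1 \<le> j \<Longrightarrow> j \<le> M \<Longrightarrow> real (r j) \<le> C2 * real j"
begin

text \<open>
  The first band keeps all its zeros on its middle circle, which corresponds to \<open>s 1 = 0\<close>.
  With \<open>s 0 = 0\<close> there are no zeros at the pole.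
\<close>

definition s :: "nat \<Rightarrow> nat" where "s j = (if j \<le> 1 then 0 else r j div 6)"
definition t :: "nat \<Rightarrow> nat" where "t j = r j - 2 * s j"
definition R :: "nat \<Rightarrow> nat" where "R j = (\<Sum>k=1..j. r k)"

text \<open>
  A single formula for all circles: for \<open>k = 2 * j\<close> both terms are \<open>R j\<close>, the end of band \<open>j\<close>, and
  for \<open>k = 2 * j + 1\<close> it is the midpoint of band \<open>j + 1\<close>.
\<close>

definition y :: "nat \<Rightarrow> real" where "y k = (real (R (k div 2)) + real (R (Suc k div 2))) / 2"
definition m :: "nat \<Rightarrow> nat" where
  "m k = (if even k then s (k div 2) + s (k div 2 + 1) else t (k div 2 + 1))"

text \<open>
  The circle number \<open>K\<close> is the equator.
\<close>

definition K :: nat where "K = 2 * M - 1"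

lemma R_0 [simp]: "R 0 = 0" by (simp add: R_def)
lemma R_Suc [simp]: "R (Suc j) = R j + r (Suc j)" by (simp add: R_def)

lemma r_split: "r j = t j + 2 * s j" unfolding t_def s_def by auto

lemma y_even: "y (2 * j) = real (R j)" by (simp add: y_def)

lemma y_odd: "y (Suc (2 * j)) = real (R j) + real (r (Suc j)) / 2"
  by (simp add: y_def add_divide_distrib)

lemma y_Suc: "y (Suc k) = y k + real (r (Suc (k div 2))) / 2"
  by (simp add: y_def add_divide_distrib)

lemma C2_pos: "0 < C2"
  using r_le[of 1] r_pos[of 1] M_ge by simp

lemma y_K: "y K = real N / 2"
proof -
  obtain m' where m': "M = Suc m'" using M_ge by (cases M) auto
  have "K = Suc (2 * m')" using K_def m' by linarith
  moreover have "N = 2 * R m' + r (Suc m')" using N_eq m' by (simp add: R_def)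
  ultimately show ?thesis by (simp only: y_odd) simp
qed

lemma m_even: "m (2 * j) = s j + s (Suc j)" by (simp add: m_def)
lemma m_odd: "m (Suc (2 * j)) = t (Suc j)" by (simp add: m_def)

text \<open>
  The critical circles are those with \<open>s j + s (j + 1)\<close> zeros: rounding down loses at most 10
  from \<open>r j + r (j + 1)\<close>, which a nonzero sum absorbs at the price of the factor 16.
\<close>

lemma m_ge:
  assumes "1 \<le> k" "k \<le> K"
  shows "m k = 0 \<or> C1 / 16 * real k \<le> real (m k)"
proof (cases "even k")
  case False
  then obtain j where k: "k = Suc (2 * j)" by (elim oddE) auto
  have j: "Suc j \<le> M" using assms unfolding k K_def by auto
  have "2 * r (Suc j) \<le> 3 * t (Suc j)" unfolding t_def s_def by auto
  then have "2 * (C1 * real (Suc j)) \<le> 3 * real (t (Suc j))"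
    using r_ge[of "Suc j"] j by linarith
  moreover have "C1 / 16 * real k \<le> C1 / 16 * (2 * real (Suc j))"
    using C1_pos unfolding k by (intro mult_left_mono) auto
  moreover have "C1 / 16 * (2 * real (Suc j)) \<le> 2 * (C1 * real (Suc j)) / 3"
    using C1_pos by (simp add: field_simps)
  ultimately show ?thesis unfolding k m_odd by linarith
next
  case True
  then obtain j where k: "k = 2 * j" by (elim evenE)
  have j: "1 \<le> j" "Suc j \<le> M" using assms unfolding k K_def by auto
  show ?thesis
  proof (cases "m k = 0")
    case False
    have "C1 * real j \<le> 8 * real (m k)"
    proof (cases "j = 1")
      case True
      have "r 2 \<le> 16 * m k" using False unfolding k m_even s_def True by (simp add: numeral_2_eq_2)
      then have "C1 * 2 \<le> 16 * real (m k)" using r_ge[of 2] M_ge by simp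
      then show ?thesis using True by simp
    next
      case j1: False
      have "r j + r (Suc j) \<le> 16 * m k"
        using False j j1 unfolding k m_even s_def by auto
      then have "C1 * real j + C1 * real (Suc j) \<le> 16 * real (m k)"
        using r_ge[of j] r_ge[of "Suc j"] j by linarith
      moreover have "C1 * real j \<le> C1 * real (Suc j)" using C1_pos by simp
      ultimately show ?thesis by linarith
    qed
    then show ?thesis unfolding k by simp
  qed simp
qed

sublocale spaced_circles "C1 / 16" C2 y m K
proof
  fix k assume k: "k < K"
  let ?j = "Suc (k div 2)"
  have j: "1 \<le> ?j" "?j \<le> M" using k unfolding K_def by auto
  have kj: "Suc k \<le> 2 * ?j" "?j \<le> 2 * Suc k" by auto
  have "C1 / 16 * real (Suc k) \<le> C1 / 16 * (2 * real ?j)"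
    using C1_pos kj(1) by (intro mult_left_mono) auto
  also have "\<dots> \<le> C1 * real ?j / 2" using C1_pos by (simp add: field_simps)
  also have "\<dots> \<le> y (Suc k) - y k" using r_ge[OF j] by (simp add: y_Suc)
  finally show "C1 / 16 * real (Suc k) \<le> y (Suc k) - y k" .
  have "y (Suc k) - y k \<le> C2 * (real ?j / 2)" using r_le[OF j] by (simp add: y_Suc)
  also have "\<dots> \<le> C2 * real (Suc k)" using C2_pos kj(2) by (intro mult_left_mono) auto
  finally show "y (Suc k) - y k \<le> C2 * real (Suc k)" .
qed (use C1_pos m_ge M_ge in \<open>auto simp: y_def K_def\<close>)

lemma sum_m_even: "(\<Sum>k=1..2*j. m k) = R j + s (Suc j)"
  and sum_m_odd: "(\<Sum>k=1..Suc (2*j). m k) + s (Suc j) = R (Suc j)"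
proof -
  show 1: "(\<Sum>k=1..2*j. m k) = R j + s (Suc j)" for j
  proof (induction j)
    case (Suc j)
    have "(\<Sum>k=1..2*Suc j. m k) = (\<Sum>k=1..2*j. m k) + m (Suc (2*j)) + m (2 * Suc j)" by simp
    then show ?case using r_split[of "Suc j"] unfolding Suc m_odd m_even by simp
  qed (simp add: s_def)
  show "(\<Sum>k=1..Suc (2*j). m k) + s (Suc j) = R (Suc j)"
    using 1[of j] r_split[of "Suc j"] by (simp add: m_odd)
qed

definition zeros :: "nat \<Rightarrow> real" where "zeros p = real (\<Sum>k=1..p. m k)"

lemma zeros_even: "zeros (2 * j) = real (R j) + real (s (Suc j))"
  unfolding zeros_def sum_m_even by simp

lemma zeros_odd: "zeros (Suc (2 * j)) = real (R (Suc j)) - real (s (Suc j))"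
  unfolding zeros_def sum_m_odd[of j, symmetric] by simp

text \<open>
  Between two consecutive circles, both the coordinate and the number of zeros lie between the
  two ends of the same band.
\<close>

lemma discrepancy:
  assumes "p < K" "y p \<le> x" "x \<le> y (Suc p)"
  shows "\<bar>zeros p - x\<bar> \<le> C2 * real (Suc p)"
proof -
  let ?j = "Suc (p div 2)"
  have s: "s i \<le> r i" for i unfolding s_def by auto
  have "\<bar>zeros p - x\<bar> \<le> real (r ?j)"
  proof (cases "even p")
    case True
    then obtain j where p: "p = 2 * j" by (elim evenE)
    show ?thesis using assms(2,3) s[of "Suc j"] unfolding y_Suc unfolding p zeros_even y_even by auto
  next
    case False
    then obtain j where p: "p = Suc (2 * j)" by (elim oddE) auto
    show ?thesis using assms(2,3) s[of "Suc j"] unfolding y_Suc unfolding p zeros_odd y_odd by auto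
  qed
  also have "\<dots> \<le> C2 * real ?j" using assms(1) by (intro r_le) (auto simp: K_def)
  also have "\<dots> \<le> C2 * real (Suc p)" using C2_pos by (intro mult_left_mono) auto
  finally show ?thesis .
qed

definition logit :: "real \<Rightarrow> real" where "logit x = ln x - ln (real N - x)"

text \<open>
  Twice the logarithm of \<open>\<bar>P z\<bar> / (1 + \<bar>z\<bar>\<^sup>2) powr (N / 2)\<close> without the correction factors, at the
  coordinate \<open>x\<close>, provided that \<open>x\<close> lies between circles \<open>p\<close> and \<open>p + 1\<close>. Only the circles up to \<open>p\<close> occur
  because a pair of mirror circles beyond \<open>x\<close> contributes \<open>a ^ m * (1 / a) ^ m = 1\<close>.
\<close>

definition potential :: "nat \<Rightarrow> real \<Rightarrow> real" where
  "potential p x = (\<Sum>k=1..p. real (m k) * (logit x - logit (y k))) + real N * (ln (real N - x) - ln (real N))"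

lemma potential_Suc: "potential (Suc p) (y (Suc p)) = potential p (y (Suc p))"
  by (simp add: potential_def)

lemma potential_diff:
  "potential p u - potential p v = zeros p * (ln u - ln v) + (real N - zeros p) * (ln (real N - u) - ln (real N - v))"
proof -
  have "potential p u - potential p v = (\<Sum>k=1..p. real (m k) * (logit u - logit v))
      + real N * (ln (real N - u) - ln (real N - v))"
    unfolding potential_def by (simp add: algebra_simps sum_subtractf sum.distrib)
  also have "(\<Sum>k=1..p. real (m k) * (logit u - logit v)) = zeros p * (logit u - logit v)"
    by (simp add: zeros_def sum_distrib_right)
  finally show ?thesis by (simp add: logit_def algebra_simps)
qed

lemma y_ge: "k \<le> K \<Longrightarrow> C1 * (real k)\<^sup>2 / 32 \<le> y k"
  using y_diff_ge[of 0 k] y_0 by (simp add: power2_eq_square)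

lemma y_le_half: "k \<le> K \<Longrightarrow> y k \<le> real N / 2"
  using y_mono[of k K] y_K by simp

lemma N_pos: "0 < N"
  using y_pos[of K] y_K K_pos by simp

definition segment_bound :: real where "segment_bound = 256 * C2\<^sup>2 / C1"

lemma segment_bound_nonneg: "0 \<le> segment_bound" using C1_pos by (simp add: segment_bound_def)

text \<open>
  This bound does not improve with \<open>p\<close>, so it can be used for a bounded number of segments only;
  the sum over all bands needs the cancellation in \<open>potential_band\<close>.
\<close>

lemma potential_segment:
  assumes "1 \<le> p" "p < K" "y p \<le> x" "x \<le> y (Suc p)"
  shows "\<bar>potential p x - potential p (y p)\<bar> \<le> segment_bound"
proof -
  have yp: "0 < y p" using y_pos assms by simp
  have "\<bar>potential p x - potential p (y p)\<bar> \<le> 2 * (C2 * real (Suc p))\<^sup>2 / y p"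
    unfolding potential_diff
  proof (rule log_segment[OF yp])
    show "x \<le> real N / 2" using y_le_half[of "Suc p"] assms by simp
    show "x - y p \<le> C2 * real (Suc p)" using gap_le[of p] assms by simp
    show "\<bar>zeros p - x'\<bar> \<le> C2 * real (Suc p)" if "y p \<le> x'" "x' \<le> x" for x'
      using discrepancy[of p x'] that assms by simp
  qed (use assms in auto)
  also have "\<dots> \<le> 2 * (C2 * (2 * real p))\<^sup>2 / (C1 * (real p)\<^sup>2 / 32)"
    using assms C1_pos C2_pos y_ge[of p]
    by (intro frac_le mult_left_mono power_mono) auto
  also have "\<dots> = segment_bound" using assms C1_pos by (simp add: segment_bound_def power2_eq_square field_simps)
  finally show ?thesis .
qed

lemma potential_polar_cap:
  assumes "0 \<le> x" "x \<le> y 1"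
  shows "\<bar>potential 0 x\<bar> \<le> C2"
proof -
  let ?u = "x / real N"
  have x: "x \<le> real N / 2" "x \<le> C2 / 2"
    using y_le_half[of 1] y_odd[of 0] r_le[of 1] assms K_pos M_ge by auto
  have "?u \<le> 1 / 2" using x N_pos by (simp add: field_simps)
  moreover have "0 \<le> ?u" using assms by simp
  ultimately have u: "0 \<le> ?u" "?u < 1" "1 / 2 \<le> 1 - ?u" by linarith+
  have "real N * (1 - ?u) = real N - x" using N_pos by (simp add: field_simps)
  then have "ln (real N - x) = ln (real N) + ln (1 - ?u)"
    using ln_mult_pos[of "real N" "1 - ?u"] N_pos u by simp
  then have potential: "potential 0 x = real N * ln (1 - ?u)" by (simp add: potential_def)
  have "?u / (1 - ?u) \<le> ?u / (1 / 2)" using u by (intro divide_left_mono mult_pos_pos) linarith+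
  then have "ln (1 - ?u) \<ge> - (?u / (1 / 2))" using ln_one_minus_bounds(1)[OF u(1,2)] by linarith
  also have "?u / (1 / 2) = 2 * ?u" by simp
  finally have "ln (1 - ?u) \<ge> - (2 * ?u)" .
  then have "potential 0 x \<ge> real N * (- (2 * ?u))" unfolding potential by (intro mult_left_mono) auto
  moreover have "real N * (- (2 * ?u)) = - (2 * x)" using N_pos by simp
  moreover have "potential 0 x \<le> 0" unfolding potential using ln_one_minus_bounds(2)[OF u(1,2)] u
    by (intro mult_nonneg_nonpos) auto
  ultimately show ?thesis using x by linarith
qed

definition \<kappa> :: real where "\<kappa> = C2 / C1"
definition band_bound :: real where "band_bound = (C2 * (16 * \<kappa>) ^ 4 + (16 * \<kappa>)\<^sup>2) * (1 + 8 * \<kappa>)"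

lemma kappa_pos: "0 < \<kappa>" using C1_pos C2_pos by (simp add: \<kappa>_def)

lemma band_bound_nonneg: "0 \<le> band_bound" using kappa_pos C2_pos by (simp add: band_bound_def)

text \<open>
  In a band \<open>d\<close> is at most of order \<open>j\<close> and \<open>c\<close> at least of order \<open>j\<^sup>2\<close>, so both terms of \<open>simpson_log\<close> are
  of order at most \<open>1 / j\<^sup>2\<close>. Any \<open>c\<close> beyond the midpoint of the band is admitted, since the
  lemma is also needed at the reflected midpoint \<open>N - c\<close>.
\<close>

lemma simpson_band:
  assumes "1 \<le> j" "2 * j + 2 \<le> K" and c: "y (Suc (2 * j)) \<le> c"
  defines "d \<equiv> real (r (Suc j)) / 2" and "\<sigma> \<equiv> real (s (Suc j))"
  shows "\<bar>(c - d + \<sigma>) * (ln c - ln (c - d)) + (c + d - \<sigma>) * (ln (c + d) - ln c) - 2 * d\<bar>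
     \<le> band_bound / (real (Suc j))\<^sup>2"
proof -
  let ?J = "real (Suc j)"
  have j: "Suc j \<le> M" using assms(2) by (simp add: K_def)
  have d0: "0 < d" using r_pos[of "Suc j"] j by (simp add: d_def)
  have d: "d \<le> C2 * ?J / 2" using r_le[of "Suc j"] j by (simp add: d_def)
  have A: "C1 * (real j)\<^sup>2 / 8 \<le> y (2 * j)" using y_ge[of "2 * j"] assms by simp
  have yc: "y (Suc (2 * j)) = y (2 * j) + d" unfolding y_odd y_even d_def ..
  have "C1 * ?J\<^sup>2 / 32 \<le> C1 * (real (Suc (2 * j)))\<^sup>2 / 32"
    using C1_pos by (intro divide_right_mono mult_left_mono power_mono) auto
  also have "\<dots> \<le> c" using y_ge[of "Suc (2 * j)"] assms by simp
  finally have c2: "C1 * ?J\<^sup>2 / 32 \<le> c" .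
  have A0: "0 < y (2 * j)" using y_pos[of "2 * j"] assms by simp
  have dc: "d < c" using c yc A0 by linarith
  have c0: "0 < c" using dc d0 by simp
  have q: "d / c \<le> 16 * \<kappa> / ?J"
  proof -
    have "d / c \<le> (C2 * ?J / 2) / (C1 * ?J\<^sup>2 / 32)"
      using d d0 c2 C1_pos C2_pos by (intro frac_le) auto
    also have "\<dots> = 16 * \<kappa> / ?J"
    proof -
      have *: "(C2 * J / 2) / (C1 * J\<^sup>2 / 32) = 16 * (C2 / C1) / J" if "0 < J" for J :: real
        using that C1_pos by (simp add: power2_eq_square)
      show ?thesis unfolding \<kappa>_def by (rule *) simp
    qed
    finally show ?thesis .
  qed
  have q0: "0 \<le> d / c" using d0 c0 by simp
  have "d \<le> 8 * \<kappa> * y (2 * j)"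
  proof -
    have "1 * 1 \<le> real j * real j" "real j * 1 \<le> real j * real j"
      using assms(1) by (intro mult_mono; simp)+
    then have "?J \<le> 2 * (real j)\<^sup>2" by (simp add: power2_eq_square)
    then have "C2 * ?J / 2 \<le> C2 * (real j)\<^sup>2" using C2_pos by simp
    also have "\<dots> = 8 * \<kappa> * (C1 * (real j)\<^sup>2 / 8)" using C1_pos by (simp add: \<kappa>_def)
    also have "\<dots> \<le> 8 * \<kappa> * y (2 * j)" using A kappa_pos by (intro mult_left_mono) auto
    finally show ?thesis using d by simp
  qed
  also have "\<dots> \<le> 8 * \<kappa> * (c - d)" using c yc kappa_pos by (intro mult_left_mono) auto
  finally have "c \<le> (1 + 8 * \<kappa>) * (c - d)" by (simp add: algebra_simps)
  then have "1 / (1 - d / c) \<le> 1 + 8 * \<kappa>" using c0 dc by (simp add: field_simps)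
  moreover have "d ^ 5 / c ^ 4 + d\<^sup>2 / c\<^sup>2 \<le> (C2 * (16 * \<kappa>) ^ 4 + (16 * \<kappa>)\<^sup>2) / ?J\<^sup>2"
  proof -
    have "d ^ 5 / c ^ 4 = d * (d / c) ^ 4" by (simp add: power_divide numeral_eq_Suc)
    also have "\<dots> \<le> (C2 * ?J / 2) * (16 * \<kappa> / ?J) ^ 4"
      using d d0 q q0 C2_pos by (intro mult_mono power_mono) auto
    also have "\<dots> = C2 * (16 * \<kappa>) ^ 4 / (2 * ?J ^ 3)" by (simp add: power_divide numeral_eq_Suc)
    also have "\<dots> \<le> C2 * (16 * \<kappa>) ^ 4 / ?J\<^sup>2"
    proof (rule divide_left_mono)
      have "1 * ?J\<^sup>2 \<le> (2 * ?J) * ?J\<^sup>2" by (intro mult_right_mono) auto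
      then show "?J\<^sup>2 \<le> 2 * ?J ^ 3" by (simp add: numeral_eq_Suc)
    qed (use C2_pos kappa_pos in auto)
    finally have 1: "d ^ 5 / c ^ 4 \<le> C2 * (16 * \<kappa>) ^ 4 / ?J\<^sup>2" .
    have "d\<^sup>2 / c\<^sup>2 = (d / c)\<^sup>2" by (simp add: power_divide)
    also have "\<dots> \<le> (16 * \<kappa> / ?J)\<^sup>2" using q q0 by (intro power_mono)
    finally have "d\<^sup>2 / c\<^sup>2 \<le> (16 * \<kappa>)\<^sup>2 / ?J\<^sup>2" by (simp add: power_divide)
    with 1 show ?thesis by (simp add: add_divide_distrib)
  qed
  ultimately have "(d ^ 5 / c ^ 4 + d\<^sup>2 / c\<^sup>2) * (1 / (1 - d / c))
      \<le> (C2 * (16 * \<kappa>) ^ 4 + (16 * \<kappa>)\<^sup>2) / ?J\<^sup>2 * (1 + 8 * \<kappa>)"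
    using dc c0 C2_pos kappa_pos by (intro mult_mono) auto
  moreover have "\<bar>2 * d - 6 * \<sigma>\<bar> \<le> 5"
  proof -
    have "r (Suc j) = 6 * s (Suc j) + r (Suc j) mod 6" "r (Suc j) mod 6 < 6"
      using assms(1) by (simp_all add: s_def)
    then show ?thesis unfolding d_def \<sigma>_def by linarith
  qed
  ultimately show ?thesis using simpson_log[OF d0 dc, of \<sigma>] by (simp add: band_bound_def)
qed

text \<open>
  The change over a band is the Simpson error seen from one pole minus the Simpson error seen
  from the other one, because \<open>logit\<close> is a difference of two logarithms.
\<close>

lemma potential_band:
  assumes "1 \<le> j" "2 * j + 2 \<le> K"
  shows "\<bar>potential (2 * Suc j) (y (2 * Suc j)) - potential (2 * j) (y (2 * j))\<bar> \<le> 2 * band_bound / (real (Suc j))\<^sup>2"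
proof -
  define c where "c = y (Suc (2 * j))"
  define d where "d = real (r (Suc j)) / 2"
  define \<sigma> where "\<sigma> = real (s (Suc j))"
  define S where "S = (\<lambda>c. (c - d + \<sigma>) * (ln c - ln (c - d)) + (c + d - \<sigma>) * (ln (c + d) - ln c) - 2 * d)"
  have yA: "y (2 * j) = c - d" and yB: "y (2 * Suc j) = c + d"
    unfolding c_def d_def y_odd y_even by simp_all
  have cA: "zeros (2 * j) = c - d + \<sigma>" unfolding zeros_even \<sigma>_def yA[symmetric] y_even ..
  have cB: "zeros (Suc (2 * j)) = c + d - \<sigma>" unfolding zeros_odd \<sigma>_def yB[symmetric] y_even ..
  have "potential (2 * Suc j) (y (2 * Suc j)) - potential (2 * j) (y (2 * j))
      = (potential (Suc (2 * j)) (c + d) - potential (Suc (2 * j)) c) + (potential (2 * j) c - potential (2 * j) (c - d))"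
    using potential_Suc[of "2 * j"] potential_Suc[of "Suc (2 * j)"] yA yB unfolding c_def[symmetric] by simp
  (* The band [c - d, c + d] is reflected to [N - c - d, N - c + d]. *)
  also have "\<dots> = S c - S (real N - c)"
  proof -
    have n: "real N - c - d = real N - (c + d)" "real N - c + d = real N - (c - d)" by simp_all
    show ?thesis unfolding potential_diff cA cB S_def n by (simp add: algebra_simps)
  qed
  finally have eq: "potential (2 * Suc j) (y (2 * Suc j)) - potential (2 * j) (y (2 * j)) = S c - S (real N - c)" .
  have "c \<le> real N - c" using y_le_half[of "Suc (2 * j)"] assms unfolding c_def by simp
  then have "\<bar>S (real N - c)\<bar> \<le> band_bound / (real (Suc j))\<^sup>2" "\<bar>S c\<bar> \<le> band_bound / (real (Suc j))\<^sup>2"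
    using simpson_band[OF assms, of "real N - c"] simpson_band[OF assms, of c]
    unfolding S_def c_def d_def \<sigma>_def by simp_all
  then show ?thesis unfolding eq by linarith
qed

text \<open>
  Telescoping, with \<open>1 / (j + 1)\<^sup>2 \<le> 1 / j - 1 / (j + 1)\<close>.
\<close>

lemma potential_even:
  assumes "1 \<le> j" "2 * j \<le> K"
  shows "\<bar>potential (2 * j) (y (2 * j))\<bar> \<le> C2 + segment_bound + 2 * band_bound * (1 - 1 / real j)"
  using assms
proof (induction j rule: dec_induct)
  case base
  have two: "2 * 1 = Suc 1" by simp
  have "\<bar>potential 1 (y (Suc 1)) - potential 1 (y 1)\<bar> \<le> segment_bound"
    by (rule potential_segment) (use base y_mono[of 1 "Suc 1"] in auto)
  moreover have "\<bar>potential 1 (y 1)\<bar> \<le> C2"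
    using potential_polar_cap[of "y 1"] potential_Suc[of 0] y_nonneg[of 1] K_pos by simp
  ultimately have "\<bar>potential (Suc 1) (y (Suc 1))\<bar> \<le> C2 + segment_bound" unfolding potential_Suc by linarith
  then show ?case unfolding two by simp
next
  case (step j)
  have "1 / (real (Suc j))\<^sup>2 \<le> 1 / (real j * real (Suc j))"
    using step.hyps by (intro divide_left_mono) (auto simp: power2_eq_square)
  also have "\<dots> = 1 / real j - 1 / real (Suc j)" using step.hyps by (simp add: field_simps)
  finally have "2 * band_bound * (1 / (real (Suc j))\<^sup>2) \<le> 2 * band_bound * (1 / real j - 1 / real (Suc j))"
    using band_bound_nonneg by (intro mult_left_mono) auto
  then have e: "2 * band_bound / (real (Suc j))\<^sup>2 \<le> 2 * band_bound * (1 - 1 / real (Suc j)) - 2 * band_bound * (1 - 1 / real j)"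
    by (simp add: algebra_simps)
  have IH: "\<bar>potential (2 * j) (y (2 * j))\<bar> \<le> C2 + segment_bound + 2 * band_bound * (1 - 1 / real j)"
    by (rule step.IH) (use step.prems in simp)
  have j: "2 * j + 2 \<le> K" using step.prems by simp
  have "\<bar>a\<bar> \<le> B + x" if "\<bar>a - b\<bar> \<le> e" "\<bar>b\<bar> \<le> B + x'" "e \<le> x - x'" for a b e B x x' :: real
    using that by linarith
  from this[OF potential_band[OF step.hyps(1) j] IH e] show ?case .
qed

definition potential_bound :: real where "potential_bound = C2 + 3 * segment_bound + 2 * band_bound"

text \<open>
  From an arbitrary point at most two segments have to be crossed towards the pole to reach
  the end of a band.
\<close>

lemma potential_le_on_segment:
  assumes "p < K" "0 \<le> x" "y p \<le> x" "x \<le> y (Suc p)"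
  shows "\<bar>potential p x\<bar> \<le> potential_bound"
proof (cases "p = 0")
  case True
  then show ?thesis using potential_polar_cap[of x] assms segment_bound_nonneg band_bound_nonneg by (simp add: potential_bound_def)
next
  case p: False
  have even: "\<bar>potential (2 * j) (y (2 * j))\<bar> \<le> C2 + segment_bound + 2 * band_bound" if "2 * j \<le> K" for j
  proof (cases "j = 0")
    case True
    then show ?thesis using potential_polar_cap[of 0] y_0 y_nonneg[of 1] K_pos segment_bound_nonneg band_bound_nonneg by simp
  next
    case False
    have "2 * band_bound * (1 - 1 / real j) \<le> 2 * band_bound" using band_bound_nonneg by (simp add: algebra_simps)
    then show ?thesis using potential_even[of j] that False by linarith
  qed
  have x: "\<bar>potential p x - potential p (y p)\<bar> \<le> segment_bound" using potential_segment[of p x] assms p by simp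
  have "\<bar>potential p (y p)\<bar> \<le> C2 + 2 * segment_bound + 2 * band_bound"
  proof (cases "even p")
    case True
    then obtain j where "p = 2 * j" by (elim evenE)
    then show ?thesis using even[of j] assms(1) segment_bound_nonneg by auto
  next
    case False
    then obtain j where pj: "p = Suc (2 * j)" by (elim oddE) auto
    have potential: "potential p (y p) = potential (2 * j) (y p)" unfolding pj by (rule potential_Suc)
    show ?thesis
    proof (cases "j = 0")
      case True
      then show ?thesis using potential_polar_cap[of "y 1"] y_nonneg[of 1] K_pos potential pj segment_bound_nonneg band_bound_nonneg by simp
    next
      case False
      have "\<bar>potential (2 * j) (y p) - potential (2 * j) (y (2 * j))\<bar> \<le> segment_bound"
        using potential_segment[of "2 * j" "y p"] False assms(1) y_mono[of "2 * j" p] pj by simp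
      then show ?thesis using even[of j] assms(1) potential pj by (simp; linarith)
    qed
  qed
  then show ?thesis using x unfolding potential_bound_def by linarith
qed

lemma logit_mono:
  assumes "0 < u" "u \<le> v" "v \<le> real N / 2"
  shows "logit u \<le> logit v"
proof -
  have "ln u \<le> ln v" "ln (real N - v) \<le> ln (real N - u)" using assms N_pos by auto
  then show ?thesis unfolding logit_def by linarith
qed

text \<open>
  The positive parts select the circles between the pole and \<open>x\<close>, so no segment number appears.
\<close>

lemma radial_potential_bounded:
  assumes "0 < x" "x \<le> real N / 2"
  shows "\<bar>(\<Sum>k=1..K. real (m k) * max 0 (logit x - logit (y k)))
           + real N * (ln (real N - x) - ln (real N))\<bar> \<le> potential_bound"
proof -
  obtain p where p: "p < K" "y p \<le> x" "x \<le> y (Suc p)"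
    using find_segment[of x] assms y_K by auto
  have split: "{1..K} = {1..p} \<union> {Suc p..K}" using p by auto
  have "(\<Sum>k=1..K. real (m k) * max 0 (logit x - logit (y k)))
      = (\<Sum>k=1..p. real (m k) * max 0 (logit x - logit (y k)))
        + (\<Sum>k=Suc p..K. real (m k) * max 0 (logit x - logit (y k)))"
    unfolding split by (rule sum.union_disjoint) auto
  also have "(\<Sum>k=Suc p..K. real (m k) * max 0 (logit x - logit (y k))) = 0"
  proof (rule sum.neutral, rule ballI)
    fix k assume k: "k \<in> {Suc p..K}"
    then have "x \<le> y k" using p y_mono[of "Suc p" k] by auto
    then have "logit x \<le> logit (y k)" using assms y_le_half[of k] k by (intro logit_mono) auto
    then show "real (m k) * max 0 (logit x - logit (y k)) = 0" by simp
  qed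
  also have "(\<Sum>k=1..p. real (m k) * max 0 (logit x - logit (y k)))
      = (\<Sum>k=1..p. real (m k) * (logit x - logit (y k)))"
  proof (rule sum.cong)
    fix k assume k: "k \<in> {1..p}"
    then have "y k \<le> x" using p y_mono[of k p] by auto
    then have "logit (y k) \<le> logit x" using assms y_pos[of k] k p by (intro logit_mono) auto
    then show "real (m k) * max 0 (logit x - logit (y k)) = real (m k) * (logit x - logit (y k))"
      by simp
  qed simp
  finally show ?thesis using potential_le_on_segment[of p x] p assms by (simp add: potential_def)
qed

end

section \<open>The polynomial as a product over circles\<close>

lemma rho_height:
  assumes "0 < n"
  shows "rho (1 - 2 * v / n) = sqrt (v / (n - v))"
proof -
  have "(1 - (1 - 2 * v / n)) / (1 + (1 - 2 * v / n)) = (2 * v / n) / (2 * (n - v) / n)"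
    using assms by (simp add: field_simps)
  also have "\<dots> = (2 * v) / (2 * (n - v))" using assms by simp
  also have "\<dots> = v / (n - v)" by (rule mult_divide_mult_cancel_left) simp
  finally show ?thesis by (simp add: rho_def)
qed

text \<open>
  This turns quotients of radii into the quotients of coordinates used by \<open>influence\<close>: for
  \<open>x \<le> v\<close> the additional factor \<open>(n - v) / (n - x)\<close> is at most 1.
\<close>

lemma sqrt_odds_ratio_le:
  fixes x v n :: real
  assumes "0 < x" "0 < v" "x \<le> n / 2" "v \<le> n / 2"
  defines "w \<equiv> sqrt (x / (n - x))" and "c \<equiv> sqrt (v / (n - v))"
  shows "min w c / max w c \<le> sqrt (min x v / max x v)"
proof -
  have ordered: "sqrt (x / (n - x)) \<le> sqrt (v / (n - v))"
      "sqrt (x / (n - x)) / sqrt (v / (n - v)) \<le> sqrt (x / v)"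
    if "0 < x" "x \<le> v" "v \<le> n / 2" for x v
  proof -
    have "x / (n - x) \<le> v / (n - v)" using that by (intro frac_le) auto
    then show "sqrt (x / (n - x)) \<le> sqrt (v / (n - v))" by simp
    have "(x / (n - x)) / (v / (n - v)) = (x / v) * ((n - v) / (n - x))" by simp
    also have "\<dots> \<le> (x / v) * 1" using that by (intro mult_left_mono) auto
    finally show "sqrt (x / (n - x)) / sqrt (v / (n - v)) \<le> sqrt (x / v)"
      by (simp flip: real_sqrt_divide)
  qed
  show ?thesis
  proof (cases "x \<le> v")
    case True
    then show ?thesis using ordered[of x v] assms by (simp add: min_absorb1 max_absorb2)
  next
    case False
    then show ?thesis using ordered[of v x] assms by (simp add: min_absorb2 max_absorb1)
  qed
qed

context band_partition
begin

definition rad :: "nat \<Rightarrow> real" where "rad k = sqrt (y k / (real N - y k))"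

text \<open>
  The equator carries a single factor; every other circle is accompanied by its mirror image.
\<close>

definition fac :: "nat \<Rightarrow> complex poly" where
  "fac k = (if k = K then monom 1 (m K) - 1
            else if m k = 0 then 1 else pair_factor (m k) (rad k))"

lemma K_odd: "K = Suc (2 * (M - 1))"
  using M_ge unfolding K_def by simp

lemma t_eq:
  assumes "2 \<le> j"
  shows "t j = 4 * s_of r j + rem_of r j"
proof -
  have "s j = r j div 6" using assms by (simp add: s_def)
  then show ?thesis
    using mult_div_mod_eq[of 6 "r j"] r_split[of j] unfolding s_of_def rem_of_def by linarith
qed

lemma m_K: "m K = 4 * s_of r M + rem_of r M" "0 < m K"
proof -
  have eq: "m K = t M" using m_odd[of "M - 1"] M_ge unfolding K_odd by simp
  then show "m K = 4 * s_of r M + rem_of r M" using t_eq M_ge by simp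
  show "0 < m K" using r_pos[of M] M_ge unfolding eq t_def s_def by auto
qed

lemma t_pos: "1 \<le> j \<Longrightarrow> j \<le> M \<Longrightarrow> 0 < t j"
  using r_pos[of j] unfolding t_def s_def by auto

lemma rho_h_mid: "rho (h_mid N r (Suc j)) = rad (Suc (2 * j))"
proof -
  have "h_mid N r (Suc j) = 1 - 2 * y (Suc (2 * j)) / real N"
    unfolding h_mid_def y_odd R_def using N_pos by (simp add: field_simps)
  then show ?thesis using rho_height[of "real N"] N_pos by (simp add: rad_def)
qed

lemma rho_h_low: "rho (h_low N r (Suc j)) = rad (2 * Suc j)"
proof -
  have "h_low N r (Suc j) = 1 - 2 * y (2 * Suc j) / real N"
    unfolding h_low_def h_mid_def y_even R_def using N_pos by (simp add: field_simps)
  then show ?thesis using rho_height[of "real N"] N_pos by (simp add: rad_def)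
qed

text \<open>
  The first partial product supplies the circles 1 and \<open>K\<close>, the second one circle 2. From there on
  the other two interleave: odd circles are the midpoints of bands, even circles their ends.
\<close>

lemma P_N_eq_prod: "P_N N M r = (\<Prod>k=1..K. fac k)"
proof -
  obtain n where M: "M = Suc (Suc n)" using M_ge by (metis Suc_le_D numeral_2_eq_2 Suc_le_mono)
  have "M - 1 = Suc n" using M by simp
  with K_odd have K: "K = Suc (2 * Suc n)" by (simp only:)
  let ?A = "\<lambda>j. pair_factor (4 * s_of r j + rem_of r j) (rho (h_mid N r j))"
  let ?B = "\<lambda>j. if s_of r j + s_of r (j + 1) = 0 then 1
                 else pair_factor (s_of r j + s_of r (j + 1)) (rho (h_low N r j))"
  have first: "fac (Suc 0) = pair_factor (r 1) (rho (h_mid N r 1))"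
  proof -
    have "m (Suc 0) = r 1" using m_odd[of 0] by (simp add: t_def s_def)
    then show ?thesis using rho_h_mid[of 0] r_pos[of 1] M_ge unfolding K fac_def by simp
  qed
  have second: "fac (Suc (Suc 0)) = P2 N r"
  proof -
    have "m (Suc (Suc 0)) = s_of r 2" using m_even[of 1] by (simp add: s_def s_of_def numeral_2_eq_2)
    then show ?thesis using rho_h_low[of 0] unfolding K fac_def P2_def by (simp add: numeral_2_eq_2)
  qed
  have odd: "fac (Suc (2 * Suc i)) = ?A (Suc (Suc i))" if "i < n" for i
  proof -
    have "m (Suc (2 * Suc i)) = 4 * s_of r (Suc (Suc i)) + rem_of r (Suc (Suc i))"
      unfolding m_odd by (rule t_eq) simp
    moreover have "0 < m (Suc (2 * Suc i))" unfolding m_odd using that M by (intro t_pos) auto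
    moreover have "Suc (2 * Suc i) \<noteq> K" using that unfolding K by simp
    ultimately show ?thesis unfolding fac_def rho_h_mid by (simp only: if_False neq0_conv[symmetric] if_not_P)
  qed
  have even: "fac (2 * Suc (Suc i)) = ?B (Suc (Suc i))" for i
  proof -
    have "2 * Suc (Suc i) \<noteq> K" unfolding K by presburger
    moreover have "m (2 * Suc (Suc i)) = s_of r (Suc (Suc i)) + s_of r (Suc (Suc i) + 1)"
      unfolding m_even by (simp add: s_def s_of_def)
    ultimately show ?thesis unfolding fac_def rho_h_low by (simp only: if_False if_cancel)
  qed
  have prods: "(\<Prod>k=1..2 * Suc i. fac k) = fac (Suc 0) * fac (Suc (Suc 0))
      * (\<Prod>j=2..Suc i. ?A j) * (\<Prod>j=2..Suc i. ?B j)" if "i \<le> n" for i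
    using that
  proof (induction i)
    case (Suc i)
    have "(\<Prod>k=1..2 * Suc (Suc i). fac k)
        = (\<Prod>k=1..2 * Suc i. fac k) * fac (Suc (2 * Suc i)) * fac (2 * Suc (Suc i))"
      by (simp add: mult_ac)
    also have "\<dots> = (fac (Suc 0) * fac (Suc (Suc 0)) * (\<Prod>j=2..Suc i. ?A j) * (\<Prod>j=2..Suc i. ?B j))
        * ?A (Suc (Suc i)) * ?B (Suc (Suc i))"
      using Suc odd[of i] even[of i] by (simp only: Suc_leD Suc_le_lessD)
    also have "\<dots> = fac (Suc 0) * fac (Suc (Suc 0))
        * (\<Prod>j=2..Suc (Suc i). ?A j) * (\<Prod>j=2..Suc (Suc i). ?B j)"
    proof -
      have *: "{2..Suc (Suc i)} = insert (Suc (Suc i)) {2..Suc i}" by auto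
      have "(\<Prod>j=2..Suc (Suc i). f j) = f (Suc (Suc i)) * (\<Prod>j=2..Suc i. f j)" for f :: "nat \<Rightarrow> complex poly"
        unfolding * by simp
      then show ?thesis by (simp only: mult_ac)
    qed
    finally show ?case .
  qed (simp add: numeral_2_eq_2)
  have "(\<Prod>k=1..K. fac k) = (\<Prod>k=1..2 * Suc n. fac k) * fac K"
    unfolding K by simp
  also have "fac K = monom 1 (4 * s_of r M + rem_of r M) - 1" unfolding fac_def m_K(1)[symmetric] by simp
  also have "(\<Prod>k=1..2 * Suc n. fac k) = pair_factor (r 1) (rho (h_mid N r 1)) * P2 N r
      * P3 N M r * P4 N M r"
    unfolding prods[OF order.refl] first second P3_def P4_def using M by simp
  finally show ?thesis unfolding P_N_def P1_def by (simp only: mult_ac)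
qed

section \<open>Size of the polynomial and of its derivative\<close>

lemma N_minus_y_pos: "k \<le> K \<Longrightarrow> 0 < real N - y k"
  using y_le_half[of k] N_pos by simp

lemma rad_pos: "1 \<le> k \<Longrightarrow> k \<le> K \<Longrightarrow> 0 < rad k"
  using y_pos[of k] N_minus_y_pos[of k] by (simp add: rad_def)

lemma rad_K: "rad K = 1"
  using N_pos by (simp add: rad_def y_K)

lemma rad_le_1: "k \<le> K \<Longrightarrow> rad k \<le> 1"
  using y_le_half[of k] N_minus_y_pos[of k] by (simp add: rad_def)

lemma rad_less_1: "k < K \<Longrightarrow> rad k < 1"
  using y_strict[of k K] N_minus_y_pos[of k] by (simp add: rad_def y_K)

lemma half_logit:
  assumes "0 < x" "x \<le> real N / 2"
  shows "ln (sqrt (x / (real N - x))) = logit x / 2"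
  using assms N_pos by (simp add: logit_def ln_sqrt ln_divide_pos)

lemma max_ratio_power:
  assumes x: "0 < x" "x \<le> real N / 2" and k: "1 \<le> k" "k \<le> K"
  shows "max 1 (sqrt (x / (real N - x)) / rad k) ^ m k
       = exp (real (m k) * max 0 (logit x - logit (y k)) / 2)"
proof -
  let ?w = "sqrt (x / (real N - x))"
  have w: "0 < ?w" using x N_pos by simp
  have "ln (rad k) = logit (y k) / 2"
    unfolding rad_def using half_logit[of "y k"] y_pos[OF k] y_le_half[of k] k by simp
  then have "ln (?w / rad k) = (logit x - logit (y k)) / 2"
    using half_logit[OF x] w rad_pos[OF k] by (simp add: ln_divide_pos diff_divide_distrib)
  then have "?w / rad k = exp ((logit x - logit (y k)) / 2)"
    using w rad_pos[OF k] by (metis divide_pos_pos exp_ln)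
  then have "max 1 (?w / rad k) = exp (max 0 (logit x - logit (y k)) / 2)"
    by (auto simp: max_def)
  then show ?thesis by (simp add: exp_of_nat_mult[symmetric])
qed

text \<open>
  The logarithm of \<open>max 1 (\<bar>z\<bar> / rad k) ^ m k\<close>, see \<open>max_ratio_power\<close>.
\<close>

definition growth :: "real \<Rightarrow> nat \<Rightarrow> real" where
  "growth x k = real (m k) * max 0 (logit x - logit (y k)) / 2"

lemma ratio_le_influence:
  assumes x: "0 < x" "x \<le> real N / 2" and k: "1 \<le> k" "k \<le> K" "m k \<noteq> 0"
  defines "w \<equiv> sqrt (x / (real N - x))"
  shows "(min w (rad k) / max w (rad k)) ^ m k \<le> influence x k"
proof -
  have w: "0 < w" using x N_pos by (simp add: w_def)
  have "min w (rad k) / max w (rad k) \<le> sqrt (min x (y k) / max x (y k))"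
    unfolding w_def rad_def using x y_pos[OF k(1,2)] y_le_half[OF k(2)] by (intro sqrt_odds_ratio_le)
  then have "(min w (rad k) / max w (rad k)) ^ m k \<le> sqrt (min x (y k) / max x (y k)) ^ m k"
    using w rad_pos[OF k(1,2)] by (intro power_mono) (auto simp: min_def max_def)
  then show ?thesis using k by (simp add: influence_def)
qed

lemma fac_bounds:
  assumes x: "0 < x" "x \<le> real N / 2" and k: "1 \<le> k" "k \<le> K" and z: "cmod z = sqrt (x / (real N - x))"
  shows "exp (growth x k) * (1 - influence x k)\<^sup>2 \<le> cmod (poly (fac k) z)"
    and "cmod (poly (fac k) z) \<le> exp (growth x k) * (1 + influence x k)\<^sup>2"
proof -
  let ?q = "influence x k"
  have z1: "cmod z \<le> 1" unfolding z using x N_pos by simp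
  have q: "0 \<le> ?q" "?q \<le> 1" using influence_nonneg influence_le_1 x k by auto
  have "exp (growth x k) * (1 - ?q)\<^sup>2 \<le> cmod (poly (fac k) z)
      \<and> cmod (poly (fac k) z) \<le> exp (growth x k) * (1 + ?q)\<^sup>2"
  proof (cases "k = K")
    case True
    have "logit x \<le> logit (y K)" using x y_K by (intro logit_mono) auto
    then have g: "exp (growth x k) = 1" by (simp add: growth_def True)
    have "cmod z ^ m K \<le> ?q"
      using ratio_le_influence[OF x k] m_K(2) z1 unfolding True rad_K z[symmetric]
      by (simp add: min_absorb1 max_absorb2)
    moreover have "1 - cmod z ^ m K \<le> cmod (poly (fac k) z)" "cmod (poly (fac k) z) \<le> 1 + cmod z ^ m K"
      using norm_power_diff_bounds[of 1 z "m K"] z1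
      by (simp_all add: True fac_def poly_monom min_absorb1 max_absorb2)
    moreover have "(1 - ?q)\<^sup>2 \<le> 1 - ?q" using q by (simp add: power2_eq_square mult_left_le)
    moreover have "1 + ?q \<le> (1 + ?q)\<^sup>2" using q by (simp add: power2_eq_square algebra_simps)
    ultimately show ?thesis unfolding g by linarith
  next
    case kK: False
    show ?thesis
    proof (cases "m k = 0")
      case True
      then show ?thesis using kK by (simp add: fac_def growth_def influence_def)
    next
      case False
      have f: "fac k = pair_factor (m k) (rad k)" using False kK by (simp add: fac_def)
      have r: "(min (cmod z) (rad k) / max (cmod z) (rad k)) ^ m k \<le> ?q"
        unfolding z using ratio_le_influence[OF x k False] .
      show ?thesis
        using norm_pair_factor_bounds[OF rad_pos[OF k] rad_le_1[OF k(2)] z1 r q(2)]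
        unfolding f z max_ratio_power[OF x k] growth_def[symmetric] by simp
    qed
  qed
  then show "exp (growth x k) * (1 - ?q)\<^sup>2 \<le> cmod (poly (fac k) z)"
    and "cmod (poly (fac k) z) \<le> exp (growth x k) * (1 + ?q)\<^sup>2" by auto
qed

text \<open>
  Exponentiated form of \<open>radial_potential_bounded\<close>, using \<open>1 + w\<^sup>2 = N / (N - x)\<close>.
\<close>

lemma exp_growth_bounds:
  assumes x: "0 < x" "x \<le> real N / 2"
  defines "w \<equiv> sqrt (x / (real N - x))"
  shows "exp (- (potential_bound / 2)) * (1 + w\<^sup>2) powr (real N / 2) \<le> exp (\<Sum>k=1..K. growth x k)"
    and "exp (\<Sum>k=1..K. growth x k) \<le> exp (potential_bound / 2) * (1 + w\<^sup>2) powr (real N / 2)"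
proof -
  have pos: "0 < real N - x" "0 < real N" using x N_pos by auto
  have "1 + w\<^sup>2 = real N / (real N - x)" using x pos by (simp add: w_def field_simps)
  then have "ln (1 + w\<^sup>2) = ln (real N) - ln (real N - x)" using pos by (simp add: ln_divide_pos)
  moreover have "1 + w\<^sup>2 \<noteq> 0" using zero_le_power2[of w] by linarith
  ultimately have "(1 + w\<^sup>2) powr (real N / 2) = exp (- (real N * (ln (real N - x) - ln (real N)) / 2))"
    by (simp add: powr_def right_diff_distrib diff_divide_distrib)
  moreover have "(\<Sum>k=1..K. growth x k) = (\<Sum>k=1..K. real (m k) * max 0 (logit x - logit (y k))) / 2"
    unfolding growth_def by (simp add: sum_divide_distrib)
  ultimately show "exp (- (potential_bound / 2)) * (1 + w\<^sup>2) powr (real N / 2) \<le> exp (\<Sum>k=1..K. growth x k)"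
    and "exp (\<Sum>k=1..K. growth x k) \<le> exp (potential_bound / 2) * (1 + w\<^sup>2) powr (real N / 2)"
    using radial_potential_bounded[OF x] by (auto simp flip: exp_add)
qed

lemma obtain_height:
  assumes "0 < w" "w \<le> 1"
  obtains x where "0 < x" "x \<le> real N / 2" "w = sqrt (x / (real N - x))"
proof -
  define x where "x = real N * w\<^sup>2 / (1 + w\<^sup>2)"
  have w: "0 < w\<^sup>2" "w\<^sup>2 \<le> 1" using assms by (auto simp: power_le_one)
  then have q: "0 < 1 + w\<^sup>2" by linarith
  have "0 < x" unfolding x_def using w q N_pos by (intro divide_pos_pos mult_pos_pos) auto
  moreover have "real N - x = real N / (1 + w\<^sup>2)" using q by (simp add: x_def field_simps)
  then have "x / (real N - x) = w\<^sup>2" using N_pos q by (simp add: x_def)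
  then have "w = sqrt (x / (real N - x))" using assms by simp
  moreover have "x \<le> real N / 2"
  proof -
    have "real N * (2 * w\<^sup>2) \<le> real N * (1 + w\<^sup>2)" using w by (intro mult_left_mono) auto
    then show ?thesis unfolding x_def pos_divide_le_eq[OF q] by simp
  qed
  ultimately show ?thesis using that by blast
qed

definition P :: "complex poly" where "P = (\<Prod>k=1..K. fac k)"

lemma P_sup_bound:
  assumes "z \<noteq> 0" "cmod z \<le> 1"
  shows "cmod (poly P z) \<le> exp (potential_bound / 2 + 6 / (1 - \<theta>)) * (1 + (cmod z)\<^sup>2) powr (real N / 2)"
proof -
  obtain x where x: "0 < x" "x \<le> real N / 2" and z: "cmod z = sqrt (x / (real N - x))"
    using obtain_height[of "cmod z"] assms by auto
  have "cmod (poly P z) = (\<Prod>k=1..K. cmod (poly (fac k) z))"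
    by (simp add: P_def poly_prod prod_norm)
  also have "\<dots> \<le> (\<Prod>k=1..K. exp (growth x k) * (1 + influence x k)\<^sup>2)"
    using fac_bounds(2)[OF x _ _ z] by (intro prod_mono) auto
  also have "\<dots> = exp (\<Sum>k=1..K. growth x k) * (\<Prod>k=1..K. 1 + influence x k)\<^sup>2"
    by (simp add: prod.distrib exp_sum prod_power_distrib)
  also have "\<dots> \<le> (exp (potential_bound / 2) * (1 + (cmod z)\<^sup>2) powr (real N / 2)) * (exp (3 / (1 - \<theta>)))\<^sup>2"
  proof (intro mult_mono power_mono)
    show "exp (\<Sum>k=1..K. growth x k) \<le> exp (potential_bound / 2) * (1 + (cmod z)\<^sup>2) powr (real N / 2)"
      unfolding z by (rule exp_growth_bounds[OF x])
    show "(\<Prod>k=1..K. 1 + influence x k) \<le> exp (3 / (1 - \<theta>))"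
      using influence_sum[of x] influence_nonneg[of x] x y_K by (intro prod_one_plus_le_exp) auto
    show "0 \<le> (\<Prod>k=1..K. 1 + influence x k)"
      using influence_nonneg[of x] x by (intro prod_nonneg) (auto simp: add_nonneg_nonneg)
  qed auto
  also have "\<dots> = exp (potential_bound / 2 + 6 / (1 - \<theta>)) * (1 + (cmod z)\<^sup>2) powr (real N / 2)"
    by (simp add: exp_add mult_ac flip: exp_double)
  finally show ?thesis .
qed

lemma reflect_P: "reflect_poly P = - P"
proof -
  have "{1..K} = insert K {1..<K}" using K_pos by auto
  then have P: "P = fac K * (\<Prod>k=1..<K. fac k)" by (simp add: P_def)
  have "reflect_poly (\<Prod>k=1..<K. fac k) = (\<Prod>k=1..<K. fac k)"
  proof (rule reflect_poly_prod_fixed)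
    fix k assume "k \<in> {1..<K}"
    then show "reflect_poly (fac k) = fac k"
      using rad_pos[of k] reflect_pair_factor[of "m k" "rad k"] by (auto simp: fac_def)
  qed
  moreover have "reflect_poly (fac K) = - fac K"
    using reflect_unit_circle_factor[OF m_K(2)] by (simp add: fac_def)
  ultimately show ?thesis unfolding P by (simp add: reflect_poly_mult)
qed

lemma degree_P: "degree P = N"
  unfolding P_def P_N_eq_prod[symmetric] using M_ge N_eq r_pos by (intro degree_P_N) auto

definition sup_const :: real where "sup_const = (exp (potential_bound / 2 + 6 / (1 - \<theta>)))\<^sup>2"

text \<open>
  Outside the unit disc the bound is carried over by \<open>z ^ N * P (1 / z) = - P z\<close>.
\<close>

lemma P_sq_bound:
  assumes "z \<noteq> 0"
  shows "(cmod (poly P z))\<^sup>2 \<le> sup_const * (1 + (cmod z)\<^sup>2) ^ degree P"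
proof -
  have inner: "(cmod (poly P z))\<^sup>2 \<le> sup_const * (1 + (cmod z)\<^sup>2) ^ N" if "z \<noteq> 0" "cmod z \<le> 1" for z
  proof -
    have p: "0 < 1 + (cmod z)\<^sup>2" by (simp add: add_pos_nonneg)
    have "(cmod (poly P z))\<^sup>2 \<le> (exp (potential_bound / 2 + 6 / (1 - \<theta>)) * (1 + (cmod z)\<^sup>2) powr (real N / 2))\<^sup>2"
      using P_sup_bound[OF that] by (intro power_mono) auto
    also have "\<dots> = sup_const * ((1 + (cmod z)\<^sup>2) powr (real N / 2))\<^sup>2" by (simp add: power_mult_distrib sup_const_def)
    also have "((1 + (cmod z)\<^sup>2) powr (real N / 2))\<^sup>2 = (1 + (cmod z)\<^sup>2) powr (real N)"
      by (simp add: power2_eq_square flip: powr_add)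
    also have "\<dots> = (1 + (cmod z)\<^sup>2) ^ N" using p by (rule powr_realpow)
    finally show ?thesis .
  qed
  show ?thesis
  proof (cases "cmod z \<le> 1")
    case True
    then show ?thesis using inner assms by (simp add: degree_P)
  next
    case False
    let ?w = "cmod z"
    have w: "0 < ?w" "inverse ?w \<le> 1" using False by (auto simp: inverse_le_1_iff)
    have "- poly P z = z ^ N * poly P (inverse z)"
      using poly_reflect_poly_nz[OF assms, of P] unfolding reflect_P degree_P by simp
    then have "cmod (poly P z) = ?w ^ N * cmod (poly P (inverse z))"
      by (metis norm_minus_cancel norm_mult norm_power)
    then have "(cmod (poly P z))\<^sup>2 = (?w ^ N)\<^sup>2 * (cmod (poly P (inverse z)))\<^sup>2"
      by (simp add: power_mult_distrib)
    also have "\<dots> \<le> (?w ^ N)\<^sup>2 * (sup_const * (1 + (cmod (inverse z))\<^sup>2) ^ N)"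
      using inner[of "inverse z"] assms w by (intro mult_left_mono) (auto simp: norm_inverse)
    also have "\<dots> = sup_const * (?w\<^sup>2 * (1 + (inverse ?w)\<^sup>2)) ^ N"
      by (simp add: power_mult_distrib norm_inverse mult_ac flip: power_mult)
    also have "?w\<^sup>2 * (1 + (inverse ?w)\<^sup>2) = 1 + ?w\<^sup>2" using w by (simp add: field_simps)
    finally show ?thesis by (simp add: degree_P)
  qed
qed

text \<open>
  The factor \<open>1 - \<theta>\<close> accounts for the mirror circle: \<open>rad p ^ (2 * m p)\<close> is at most the influence
  of circle \<open>p\<close> on the equator.
\<close>

lemma fac_zero:
  assumes p: "1 \<le> p" "p \<le> K" and z: "cmod z \<le> 1" "poly (fac p) z = 0"
  shows "m p \<noteq> 0" "cmod z = rad p"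
    and "real (m p) / rad p * (1 - \<theta>) \<le> cmod (poly (pderiv (fac p)) z)"
proof -
  have "m p \<noteq> 0 \<and> cmod z = rad p
      \<and> real (m p) / rad p * (1 - \<theta>) \<le> cmod (poly (pderiv (fac p)) z)"
  proof (cases "p = K")
    case True
    have "z ^ m K = 1" using z by (simp add: True fac_def poly_monom)
    then have "cmod z ^ m K = 1 ^ m K" by (metis norm_one norm_power power_one)
    then have w: "cmod z = 1" using power_eq_imp_eq_base[of "cmod z" "m K" 1] m_K(2) by simp
    have "poly (pderiv (fac p)) z = of_nat (m K) * z ^ (m K - 1)"
      by (simp add: True fac_def pderiv_diff pderiv_monom poly_monom)
    then have "cmod (poly (pderiv (fac p)) z) = real (m K)"
      by (simp add: norm_mult norm_power w)
    moreover have "real (m K) * (1 - \<theta>) \<le> real (m K)" using theta by (simp add: mult_left_le)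
    ultimately show ?thesis using m_K(2) w by (simp add: True rad_K)
  next
    case False
    then have pK: "p < K" using p by simp
    have mp: "m p \<noteq> 0" using z pK by (auto simp: fac_def split: if_splits)
    then have f: "fac p = pair_factor (m p) (rad p)" using pK by (simp add: fac_def)
    have rp: "0 < rad p" "rad p < 1" using rad_pos rad_less_1 p pK by auto
    have yK: "sqrt (y K / (real N - y K)) = 1" using rad_K by (simp add: rad_def)
    have "rad p ^ (2 * m p) \<le> rad p ^ m p" using rp by (intro power_decreasing) auto
    also have "\<dots> = (min 1 (rad p) / max 1 (rad p)) ^ m p"
      using rp by (simp add: min_absorb2 max_absorb1)
    also have "\<dots> \<le> influence (y K) p"
      using ratio_le_influence[OF _ _ p mp, of "y K", unfolded yK] y_pos[of K] y_le_half[of K] K_pos by simp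
    also have "\<dots> \<le> \<theta>" using influence_at_node[of K p] p pK by simp
    finally have "real (m p) / rad p * (1 - \<theta>) \<le> real (m p) / rad p * (1 - rad p ^ (2 * m p))"
      using rp by (intro mult_left_mono) auto
    then show ?thesis
      using pair_factor_inner_zero[of "m p" "rad p" z] mp rp z unfolding f by simp
  qed
  then show "m p \<noteq> 0" "cmod z = rad p"
    and "real (m p) / rad p * (1 - \<theta>) \<le> cmod (poly (pderiv (fac p)) z)" by auto
qed

text \<open>
  The circle number \<open>p\<close> has radius at most of order \<open>p / sqrt N\<close> and carries at least of order
  \<open>p\<close> zeros, so the spacing of its zeros is of order at most \<open>1 / sqrt N\<close>.
\<close>

lemma mult_over_rad_ge:
  assumes "1 \<le> p" "p \<le> K" "m p \<noteq> 0"
  shows "C1 / 16 / sqrt (2 * C2) * sqrt (real N) \<le> real (m p) / rad p"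
proof -
  have "rad p \<le> sqrt (C2 * (real p)\<^sup>2 / (real N / 2))"
    unfolding rad_def using y_le[of p] y_nonneg[of p] y_le_half[of p] assms N_pos
    by (intro real_sqrt_le_mono frac_le) auto
  also have "C2 * (real p)\<^sup>2 / (real N / 2) = (real p)\<^sup>2 * (2 * C2 / real N)" by simp
  also have "sqrt \<dots> = real p * (sqrt (2 * C2) / sqrt (real N))"
    by (simp add: real_sqrt_mult real_sqrt_divide)
  finally have "rad p \<le> real p * (sqrt (2 * C2) / sqrt (real N))" .
  then have "C1 / 16 * real p / (real p * (sqrt (2 * C2) / sqrt (real N))) \<le> real (m p) / rad p"
    using mult_ge[of p] assms rad_pos[of p] C1_pos by (intro frac_le) auto
  then show ?thesis using assms by simp
qed

text \<open>
  The product of the lower bounds for the own circle, for the radial potential, and for the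
  correction factors of the remaining circles (squared, as they come in mirror pairs).
\<close>

definition \<eta> :: real where
  "\<eta> = C1 / 16 / sqrt (2 * C2) * (1 - \<theta>) * exp (- (potential_bound / 2)) * (exp (- (3 / (1 - \<theta>) / (1 - \<theta>))))\<^sup>2"

lemma eta_pos: "0 < \<eta>" using C1_pos C2_pos theta by (simp add: \<eta>_def)

lemma P_deriv_bound:
  assumes z: "z \<noteq> 0" "cmod z \<le> 1" "poly P z = 0"
  shows "\<eta> * sqrt (real N) * (1 + (cmod z)\<^sup>2) powr (real N / 2 - 1) \<le> cmod (poly (pderiv P) z)"
proof -
  obtain p where p: "1 \<le> p" "p \<le> K" and zp: "poly (fac p) z = 0"
    using z(3) by (auto simp: P_def poly_prod)
  note fz = fac_zero[OF p z(2) zp]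
  have x: "0 < y p" "y p \<le> real N / 2" using y_pos y_le_half p by auto
  have cz: "cmod z = sqrt (y p / (real N - y p))" using fz(2) by (simp add: rad_def)
  let ?I = "{1..K} - {p}"
  let ?Q = "\<Prod>k\<in>?I. fac k"
  let ?e = "exp (- (3 / (1 - \<theta>) / (1 - \<theta>)))"
  have "P = fac p * ?Q" unfolding P_def using p by (intro prod.remove) auto
  then have "poly (pderiv P) z = poly ?Q z * poly (pderiv (fac p)) z"
    using zp by (simp add: pderiv_mult)
  then have eq: "cmod (poly (pderiv P) z) = cmod (poly ?Q z) * cmod (poly (pderiv (fac p)) z)"
    by (simp add: norm_mult)
  have e: "?e \<le> (\<Prod>k\<in>?I. 1 - influence (y p) k)"
  proof (rule prod_one_minus_ge_exp)
    have "(\<Sum>k\<in>?I. influence (y p) k) \<le> (\<Sum>k=1..K. influence (y p) k)"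
      using influence_nonneg[of "y p"] x by (intro sum_mono2) auto
    also have "\<dots> \<le> 3 / (1 - \<theta>)" using x y_K by (intro influence_sum) auto
    finally show "(\<Sum>k\<in>?I. influence (y p) k) \<le> 3 / (1 - \<theta>)" .
  qed (use influence_nonneg[of "y p"] influence_at_node[of p] x p theta in auto)
  (* Leaving out circle p loses nothing: its growth at its own coordinate is 0. *)
  have g: "(\<Sum>k\<in>?I. growth (y p) k) = (\<Sum>k=1..K. growth (y p) k)"
    using p by (subst sum.remove[of "{1..K}" p]) (auto simp: growth_def)
  have "exp (- (potential_bound / 2)) * (1 + (cmod z)\<^sup>2) powr (real N / 2) * ?e\<^sup>2
      \<le> exp (\<Sum>k\<in>?I. growth (y p) k) * (\<Prod>k\<in>?I. 1 - influence (y p) k)\<^sup>2"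
    unfolding g cz using exp_growth_bounds(1)[OF x] e by (intro mult_mono power_mono) auto
  also have "\<dots> = (\<Prod>k\<in>?I. exp (growth (y p) k) * (1 - influence (y p) k)\<^sup>2)"
    by (simp add: prod.distrib exp_sum prod_power_distrib)
  also have "\<dots> \<le> (\<Prod>k\<in>?I. cmod (poly (fac k) z))"
    using fac_bounds(1)[OF x _ _ cz] by (intro prod_mono) auto
  also have "\<dots> = cmod (poly ?Q z)" by (simp add: poly_prod prod_norm)
  finally have Q: "exp (- (potential_bound / 2)) * (1 + (cmod z)\<^sup>2) powr (real N / 2) * ?e\<^sup>2 \<le> cmod (poly ?Q z)" .
  have "C1 / 16 / sqrt (2 * C2) * sqrt (real N) * (1 - \<theta>) \<le> real (m p) / rad p * (1 - \<theta>)"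
    using mult_over_rad_ge[OF p fz(1)] theta by (intro mult_right_mono) auto
  also note fz(3)
  finally have F: "C1 / 16 / sqrt (2 * C2) * sqrt (real N) * (1 - \<theta>) \<le> cmod (poly (pderiv (fac p)) z)" .
  have "(1 + (cmod z)\<^sup>2) powr (real N / 2 - 1) \<le> (1 + (cmod z)\<^sup>2) powr (real N / 2)"
    by (intro powr_mono) auto
  then have "\<eta> * sqrt (real N) * (1 + (cmod z)\<^sup>2) powr (real N / 2 - 1)
      \<le> \<eta> * sqrt (real N) * (1 + (cmod z)\<^sup>2) powr (real N / 2)"
    using eta_pos by (intro mult_left_mono) auto
  also have "\<dots> = (exp (- (potential_bound / 2)) * (1 + (cmod z)\<^sup>2) powr (real N / 2) * ?e\<^sup>2)
      * (C1 / 16 / sqrt (2 * C2) * sqrt (real N) * (1 - \<theta>))"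
    unfolding \<eta>_def by (simp only: mult_ac)
  also have "\<dots> \<le> cmod (poly ?Q z) * cmod (poly (pderiv (fac p)) z)"
    using Q F C1_pos C2_pos theta by (intro mult_mono) auto
  finally show ?thesis unfolding eq .
qed

lemma P_nonzero_0: "poly P 0 \<noteq> 0"
proof -
  have "P \<noteq> 0" using degree_P N_pos by auto
  then have "coeff (reflect_poly P) 0 \<noteq> 0" by simp
  then show ?thesis unfolding reflect_P by (simp add: poly_0_coeff_0)
qed

definition cond_const where "cond_const = sqrt (2 * sup_const) / \<eta>"

lemma mu_norm_at_inner:
  assumes z: "z \<noteq> 0" "cmod z \<le> 1" "poly P z = 0"
  shows "mu_norm_at P z \<le> ereal (cond_const * sqrt (real N))"
proof -
  let ?A = "(1 + (cmod z)\<^sup>2) powr (real N / 2 - 1)" and ?d = "cmod (poly (pderiv P) z)"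
  have A: "0 < ?A" by (simp add: add_pos_nonneg) (metis add_pos_nonneg less_numeral_extra(1,3) zero_le_power2)
  have d: "\<eta> * sqrt (real N) * ?A \<le> ?d" by (rule P_deriv_bound[OF z])
  have lb: "0 < \<eta> * sqrt (real N) * ?A" using eta_pos N_pos A by simp
  have nz: "poly (pderiv P) z \<noteq> 0" using d lb by auto
  have "weyl_norm P \<le> sqrt ((real (degree P) + 1) * sup_const)"
    using P_sq_bound by (rule weyl_norm_le_sup)
  also have "\<dots> \<le> sqrt ((2 * real N) * sup_const)"
    using N_pos unfolding degree_P by (intro real_sqrt_le_mono mult_right_mono) (auto simp: sup_const_def)
  also have "\<dots> = sqrt (2 * sup_const) * sqrt (real N)" by (simp add: real_sqrt_mult)
  finally have w: "weyl_norm P \<le> sqrt (2 * sup_const) * sqrt (real N)" .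
  have "sqrt (real N) * (weyl_norm P * ?A / ?d)
      \<le> sqrt (real N) * ((sqrt (2 * sup_const) * sqrt (real N)) * ?A / (\<eta> * sqrt (real N) * ?A))"
    using w A d lb by (intro mult_left_mono frac_le mult_right_mono) (auto simp: sup_const_def)
  also have "\<dots> = cond_const * sqrt (real N)" using A N_pos eta_pos by (simp add: cond_const_def)
  finally show ?thesis unfolding mu_norm_at_def degree_P using nz by simp
qed

lemma mu_norm_P: "mu_norm P \<le> ereal (cond_const * sqrt (real N))"
proof -
  have P0: "P \<noteq> 0" using degree_P N_pos by auto
  have fin: "finite {z. poly P z = 0}" by (rule poly_roots_finite[OF P0])
  have "\<not> constant (poly P)" using degree_P N_pos by (simp add: constant_degree)
  then have ne: "{z. poly P z = 0} \<noteq> {}" using fundamental_theorem_of_algebra[of P] by auto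
  have "mu_norm_at P z \<le> ereal (cond_const * sqrt (real N))" if "poly P z = 0" for z
  proof -
    have z0: "z \<noteq> 0" using that P_nonzero_0 by auto
    show ?thesis
    proof (cases "cmod z \<le> 1")
      case True
      then show ?thesis using mu_norm_at_inner z0 that by simp
    next
      case False
      have "- poly P z = z ^ N * poly P (inverse z)"
        using poly_reflect_poly_nz[OF z0, of P] unfolding reflect_P degree_P by simp
      then have "poly P (inverse z) = 0" using that z0 by simp
      moreover have "cmod (inverse z) \<le> 1" using False by (simp add: norm_inverse inverse_le_1_iff)
      ultimately have "mu_norm_at P (inverse z) \<le> ereal (cond_const * sqrt (real N))"
        using mu_norm_at_inner z0 by simp
      then show ?thesis using mu_norm_at_reciprocal[OF reflect_P z0 that] by simp
    qed
  qed
  then show ?thesis unfolding mu_norm_def using fin ne by (subst Max_le_iff) auto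
qed

end

theorem theorem1p5:
  fixes C1 C2 :: real
  assumes "C1 > 0" and "C2 > 0"
  shows "\<exists>C::real. C > 0 \<and>
    (\<forall>(N::nat) (M::nat) (r::nat \<Rightarrow> nat).
       N \<ge> 1 \<longrightarrow> M \<ge> 2 \<longrightarrow>
       (\<forall>j\<in>{1..M}. 0 < r j) \<longrightarrow>
       N = r M + 2 * (\<Sum>j=1..M-1. r j) \<longrightarrow>
       (\<forall>j\<in>{1..M}. C1 * real j \<le> real (r j) \<and> real (r j) \<le> C2 * real j) \<longrightarrow>
       mu_norm (P_N N M r) \<le> ereal (C * sqrt (real N)))"
proof (intro exI[of _ "max 1 (band_partition.cond_const C1 C2)"] conjI allI impI)
  fix N M :: nat and r :: "nat \<Rightarrow> nat"
  assume "N \<ge> 1" "M \<ge> 2" "\<forall>j\<in>{1..M}. 0 < r j" "N = r M + 2 * (\<Sum>j=1..M-1. r j)"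
    "\<forall>j\<in>{1..M}. C1 * real j \<le> real (r j) \<and> real (r j) \<le> C2 * real j"
  then interpret band_partition C1 C2 N M r
    using assms by unfold_locales auto
  have "mu_norm (P_N N M r) \<le> ereal (cond_const * sqrt (real N))"
    using mu_norm_P unfolding P_def P_N_eq_prod .
  also have "\<dots> \<le> ereal (max 1 cond_const * sqrt (real N))" by (simp add: mult_right_mono)
  finally show "mu_norm (P_N N M r) \<le> ereal (max 1 cond_const * sqrt (real N))" .
qed simp

end
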